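(* Let $X$ be a finite set of points in $\mathbb{R}^d$ and let $r \ge 1$ be an integer. If $|X| \ge (d+1)(r-1)+2$, then the graph $\mathbf{RG}_{\mathrm{Tv}}(X,r)$ is connected.
   Context: An ordered Tverberg $r$-partition of a finite set $Y \subset \mathbb{R}^d$ is an ordered tuple $(Y_1,\ldots,Y_r)$ of pairwise disjoint subsets (possibly empty) with $Y_1 \cup \cdots \cup Y_r = Y$ and $\bigcap_{i=1}^r \mathrm{conv}(Y_i) \neq \emptyset$ (with $\mathrm{conv}(\emptyset)=\emptyset$). The graph $\mathbf{RG}_{\mathrm{Tv}}(X,r)$ has as vertices all ordered Tverberg $r$-partitions of $X$; two of them are adjacent if they differ only in the placement of a single point $x \in X$ among the $r$ classes, and deleting $x$ from either of the two partitions yields an ordered Tverberg $r$-partition of $X \setminus \{x\}$. *)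

theory Defs
  imports "HOL-Analysis.Analysis"
begin

text \<open>An ordered Tverberg r-partition of Y is represented as a map P from class
indices to sets: classes P 0, ..., P (r-1), with P i = {} for i >= r (canonical form).\<close>

definition tverberg_partition :: "'a::euclidean_space set \<Rightarrow> nat \<Rightarrow> (nat \<Rightarrow> 'a set) \<Rightarrow> bool" where
  "tverberg_partition Y r P \<longleftrightarrow>
     (\<forall>i j. i < r \<and> j < r \<and> i \<noteq> j \<longrightarrow> P i \<inter> P j = {}) \<and>
     (\<Union>i<r. P i) = Y \<and>
     (\<forall>i. r \<le> i \<longrightarrow> P i = {}) \<and>
     (\<Inter>i<r. convex hull (P i)) \<noteq> {}"

definition tv_adjacent :: "'a::euclidean_space set \<Rightarrow> nat \<Rightarrow> (nat \<Rightarrow> 'a set) \<Rightarrow> (nat \<Rightarrow> 'a set) \<Rightarrow> bool" where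
  "tv_adjacent X r P Q \<longleftrightarrow>
     tverberg_partition X r P \<and> tverberg_partition X r Q \<and> P \<noteq> Q \<and>
     (\<exists>x\<in>X. (\<forall>i. P i - {x} = Q i - {x}) \<and>
        tverberg_partition (X - {x}) r (\<lambda>i. P i - {x}) \<and>
        tverberg_partition (X - {x}) r (\<lambda>i. Q i - {x}))"

definition RG_Tv_edges :: "'a::euclidean_space set \<Rightarrow> nat \<Rightarrow> ((nat \<Rightarrow> 'a set) \<times> (nat \<Rightarrow> 'a set)) set" where
  "RG_Tv_edges X r = {(P, Q). tv_adjacent X r P Q}"

end

theory Submission
  imports Defs
begin

text \<open>
  By Sarkaria's tensor trick, ordered Tverberg partitions of \<open>X\<close> correspond to choices of one vector from
  each of \<open>|X| \<ge> N + 2\<close> classes in \<open>\<real>\<^sup>N\<close>, \<open>N = (d + 1)(r - 1)\<close>, with \<open>0\<close> in the convex hull of the chosen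
  vectors; each class sums to \<open>0\<close>. So it suffices to connect such transversals by single exchanges.

  For \<open>N + 1\<close> classes in general position and a target \<open>q\<close>, the transversals whose cone contains \<open>q\<close> are
  connected, by induction on the dimension. Moving \<open>q\<close> along a segment does not affect connectedness: where
  \<open>q\<close> crosses a cone \<open>\<tau>\<close>, the transversals extending \<open>\<tau>\<close> on either side are again governed by the statement
  modulo the span of \<open>\<tau>\<close>. So \<open>q\<close> may be moved to a vector \<open>c\<close> of some class \<open>x\<close>. There every transversal
  can be moved to one not using class \<open>x\<close>, by minimising the coefficient of \<open>x\<close>, and then to one that
  contains \<open>c\<close>.

  With \<open>q\<close> the negative of a vector of one more class, this gives the case of \<open>N + 2\<close> generic classes.
  Arbitrary classes are handled by perturbation, more classes by induction.
\<close>

text \<open>The count \<open>N + 1\<close> is chosen so that the vectors left after omitting any one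
  class form a basis: a representation of \<open>q\<close> is then unique up to one parameter, and
  lying in a cone that omits a class is a finite list of affine sign conditions. The induction
  descends only if the face \<open>\<tau>\<close> met by the moving target is nonempty, so the
  segment must stay off the subspace already divided out. That is possible because each class sums
  to 0: if the segments to all vectors of a class met this subspace, a positive combination would
  put \<open>q\<close> itself into it. One class beyond these serves as the target. It can be
  changed at transversals whose other classes capture the origin, and for \<open>N + 1\<close>
  generic classes such transversals always exist. A perturbation has to preserve zero sums and one
  given transversal, and the two perturbations needed must be generic jointly. Hence classes are
  shifted one after another, each along a single line with weights \<open>1\<close> and
  \<open>-1 / (r - 1)\<close>, and general position refers to pools of vectors.\<close>

lemma affine_pos_eventually:
  fixes a b :: "'c \<Rightarrow> real"
  assumes "finite T" "\<forall>x\<in>T. a x > 0"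
  obtains \<delta> where "\<delta> > 0" "\<And>x t. x \<in> T \<Longrightarrow> \<bar>t\<bar> \<le> \<delta> \<Longrightarrow> a x + t * b x > 0"
proof -
  have "\<exists>\<delta>>0. \<forall>x\<in>T. \<forall>t. \<bar>t\<bar> \<le> \<delta> \<longrightarrow> a x + t * b x > 0"
    using assms
  proof (induction T rule: finite_induct)
    case empty
    then show ?case by (auto intro: exI[of _ 1])
  next
    case (insert y T)
    then obtain \<delta> where \<delta>: "\<delta> > 0" "\<forall>x\<in>T. \<forall>t. \<bar>t\<bar> \<le> \<delta> \<longrightarrow> a x + t * b x > 0"
      by auto
    define e where "e = a y / (2 * (\<bar>b y\<bar> + 1))"
    have ay: "a y > 0" using insert by simp
    have e: "e > 0" unfolding e_def using ay by (intro divide_pos_pos) auto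
    have "a y + t * b y > 0" if "\<bar>t\<bar> \<le> e" for t
    proof -
      have "\<bar>t * b y\<bar> \<le> e * (\<bar>b y\<bar> + 1)"
        unfolding abs_mult using that by (intro mult_mono) auto
      also have "\<dots> = a y / 2" unfolding e_def by (simp add: field_simps)
      finally show ?thesis using ay by (simp add: abs_le_iff)
    qed
    then show ?case using \<delta> e by (intro exI[of _ "min \<delta> e"]) auto
  qed
  then show ?thesis using that by blast
qed

lemma finite_agreeing:
  fixes \<sigma>0 :: "'c \<Rightarrow> nat"
  assumes "finite A"
  shows "finite {\<sigma>. (\<forall>x. \<sigma> x < r) \<and> (\<forall>x. x \<notin> A \<longrightarrow> \<sigma> x = \<sigma>0 x)}" (is "finite ?S")
proof (rule finite_subset)
  show "?S \<subseteq> (\<lambda>f x. if x \<in> A then f x else \<sigma>0 x) ` (A \<rightarrow>\<^sub>E {..<r})"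
  proof
    fix \<sigma> assume s: "\<sigma> \<in> ?S"
    then have "\<sigma> = (\<lambda>x. if x \<in> A then restrict \<sigma> A x else \<sigma>0 x)" "restrict \<sigma> A \<in> A \<rightarrow>\<^sub>E {..<r}"
      by (auto simp: fun_eq_iff)
    then show "\<sigma> \<in> (\<lambda>f x. if x \<in> A then f x else \<sigma>0 x) ` (A \<rightarrow>\<^sub>E {..<r})" by blast
  qed
  show "finite ((\<lambda>f x. if x \<in> A then f x else \<sigma>0 x) ` (A \<rightarrow>\<^sub>E {..<r}))"
    using assms by (intro finite_imageI finite_PiE) auto
qed

section \<open>Generic classes\<close>

text \<open>The intended \<open>I\<close> has one class more than the dimension of \<open>V\<close>.
  The last two conditions say that the vectors chosen from all classes but \<open>y\<close> form a
  basis. Coefficient functions vanishing at \<open>y\<close> keep the families indexed by classes,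
  so that no injectivity has to be tracked.\<close>

locale generic_classes =
  fixes u :: "'c \<Rightarrow> nat \<Rightarrow> 'v::real_vector" and r :: nat and I :: "'c set" and V :: "'v set"
  assumes finite_I: "finite I"
    and subspace_V: "subspace V"
    and u_in_V: "x \<in> I \<Longrightarrow> i < r \<Longrightarrow> u x i \<in> V"
    and class_sum: "x \<in> I \<Longrightarrow> (\<Sum>i<r. u x i) = 0"
    and spanning: "\<forall>x. \<sigma> x < r \<Longrightarrow> y \<in> I \<Longrightarrow> v \<in> V \<Longrightarrow>
      \<exists>a. a y = 0 \<and> v = (\<Sum>x\<in>I. a x *\<^sub>R u x (\<sigma> x))"
    and independence: "\<forall>x. \<sigma> x < r \<Longrightarrow> y \<in> I \<Longrightarrow> a y = 0 \<Longrightarrow>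
      (\<Sum>x\<in>I. a x *\<^sub>R u x (\<sigma> x)) = 0 \<Longrightarrow> x \<in> I \<Longrightarrow> a x = 0"
begin

abbreviation comb :: "('c \<Rightarrow> nat) \<Rightarrow> ('c \<Rightarrow> real) \<Rightarrow> 'v" where
  "comb \<sigma> a \<equiv> (\<Sum>x\<in>I. a x *\<^sub>R u x (\<sigma> x))"

text \<open>Values are frozen on \<open>F\<close> and also off \<open>I\<close>, so that the set is
  finite and equal functions are equal transversals.\<close>

definition transv :: "'c set \<Rightarrow> ('c \<Rightarrow> nat) \<Rightarrow> ('c \<Rightarrow> nat) set" where
  "transv F \<sigma>0 = {\<sigma>. (\<forall>x. \<sigma> x < r) \<and> (\<forall>x. x \<notin> I - F \<longrightarrow> \<sigma> x = \<sigma>0 x)}"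

text \<open>The colours in \<open>F\<close> carry coefficients of arbitrary sign. This stands for passing to the
  quotient by the span of the vectors chosen from these colours.\<close>

definition rep :: "'c set \<Rightarrow> ('c \<Rightarrow> nat) \<Rightarrow> 'v \<Rightarrow> ('c \<Rightarrow> real) \<Rightarrow> bool" where
  "rep F \<sigma> q a \<longleftrightarrow> q = comb \<sigma> a \<and> (\<forall>x\<in>I - F. 0 \<le> a x)"

definition good :: "'c set \<Rightarrow> ('c \<Rightarrow> nat) \<Rightarrow> 'v \<Rightarrow> bool" where
  "good F \<sigma> q \<longleftrightarrow> (\<exists>a. rep F \<sigma> q a)"

definition good_without :: "'c set \<Rightarrow> 'c \<Rightarrow> ('c \<Rightarrow> nat) \<Rightarrow> 'v \<Rightarrow> bool" where
  "good_without F y \<sigma> q \<longleftrightarrow> (\<exists>a. rep F \<sigma> q a \<and> a y = 0)"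

definition step :: "'c set \<Rightarrow> 'v \<Rightarrow> (('c \<Rightarrow> nat) \<times> ('c \<Rightarrow> nat)) set" where
  "step F q = {(\<sigma>, \<sigma>(y := i)) | \<sigma> y i. y \<in> I - F \<and> i < r \<and> (\<forall>x. \<sigma> x < r) \<and> good_without F y \<sigma> q}"

text \<open>The linear span of the vectors chosen from \<open>F\<close>, which is the subspace
  divided out; for empty \<open>F\<close> it is the zero space.\<close>

definition flat :: "'c set \<Rightarrow> ('c \<Rightarrow> nat) \<Rightarrow> 'v set" where
  "flat F \<sigma> = {v. \<exists>a. (\<forall>x\<in>I - F. a x = 0) \<and> v = comb \<sigma> a}"

lemma comb_cong: "(\<And>x. x \<in> I \<Longrightarrow> a x \<noteq> 0 \<Longrightarrow> \<sigma> x = \<sigma>' x) \<Longrightarrow> comb \<sigma> a = comb \<sigma>' a"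
  by (intro sum.cong) auto

lemma comb_add: "comb \<sigma> (\<lambda>x. a x + b x) = comb \<sigma> a + comb \<sigma> b"
  by (simp add: scaleR_add_left sum.distrib)

lemma comb_diff: "comb \<sigma> (\<lambda>x. a x - b x) = comb \<sigma> a - comb \<sigma> b"
  by (simp add: scaleR_diff_left sum_subtractf)

lemma comb_scale: "comb \<sigma> (\<lambda>x. t * a x) = t *\<^sub>R comb \<sigma> a"
  by (simp add: scaleR_sum_right)

lemma comb_axpy: "comb \<sigma> (\<lambda>x. a x + t * b x) = comb \<sigma> a + t *\<^sub>R comb \<sigma> b"
  by (simp add: scaleR_add_left sum.distrib scaleR_sum_right)

lemma comb_unit: "y \<in> I \<Longrightarrow> comb \<sigma> (\<lambda>x. if x = y then 1 else 0) = u y (\<sigma> y)"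
  using finite_I by (simp add: if_distrib[of "\<lambda>c. c *\<^sub>R _"] sum.delta cong: if_cong)

lemma unique_rep:
  assumes "\<forall>x. \<sigma> x < r" "y \<in> I" "a y = 0" "b y = 0" "comb \<sigma> a = comb \<sigma> b" "x \<in> I"
  shows "a x = b x"
  using independence[of \<sigma> y "\<lambda>x. a x - b x" x] assms comb_diff[of a b \<sigma>] by simp

lemma finite_transv: "finite (transv F \<sigma>0)"
  unfolding transv_def using finite_agreeing[of "I - F"] finite_I by simp

lemma transvD: "\<sigma> \<in> transv F \<sigma>0 \<Longrightarrow> \<forall>x. \<sigma> x < r"
  by (simp add: transv_def)

lemma subspace_flat: "subspace (flat F \<sigma>)"
proof (rule subspaceI)
  show "0 \<in> flat F \<sigma>" unfolding flat_def by (auto intro!: exI[of _ "\<lambda>_. 0"])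
next
  fix v w assume "v \<in> flat F \<sigma>" "w \<in> flat F \<sigma>"
  then obtain a b where "\<forall>x\<in>I - F. a x = 0" "v = comb \<sigma> a" "\<forall>x\<in>I - F. b x = 0" "w = comb \<sigma> b"
    unfolding flat_def by blast
  then show "v + w \<in> flat F \<sigma>" unfolding flat_def
    by (auto intro!: exI[of _ "\<lambda>x. a x + b x"] simp: comb_add)
next
  fix v c assume "v \<in> flat F \<sigma>"
  then obtain a where "\<forall>x\<in>I - F. a x = 0" "v = comb \<sigma> a"
    unfolding flat_def by blast
  then show "c *\<^sub>R v \<in> flat F \<sigma>" unfolding flat_def
    by (auto intro!: exI[of _ "\<lambda>x. c * a x"] simp: comb_scale[symmetric])
qed

lemma stepI:
  "y \<in> I - F \<Longrightarrow> i < r \<Longrightarrow> \<forall>x. \<sigma> x < r \<Longrightarrow> good_without F y \<sigma> q \<Longrightarrow>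
    (\<sigma>, \<sigma>(y := i)) \<in> step F q"
  unfolding step_def by blast

text \<open>A class with coefficient 0 may take any vector without spoiling the representation, so
  the same \<open>a\<close> serves all along the path. Induction on the finite set of classes where
  the two transversals differ.\<close>

lemma change_free:
  assumes "rep F \<sigma> q a" "\<forall>x. \<sigma> x < r" "\<forall>x. \<sigma>' x < r"
    and "\<And>x. \<sigma>' x \<noteq> \<sigma> x \<Longrightarrow> x \<in> I - F \<and> a x = 0"
  shows "(\<sigma>, \<sigma>') \<in> (step F q)\<^sup>*"
proof -
  have "finite D \<Longrightarrow> D \<subseteq> I - F \<Longrightarrow> \<forall>x\<in>D. a x = 0 \<Longrightarrow> \<forall>x. x \<notin> D \<longrightarrow> \<sigma>' x = \<sigma> x \<Longrightarrow>
     (\<forall>x. \<sigma>' x < r) \<Longrightarrow> (\<sigma>, \<sigma>') \<in> (step F q)\<^sup>*" for D \<sigma>'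
  proof (induction D arbitrary: \<sigma>' rule: finite_induct)
    case empty
    then have "\<sigma>' = \<sigma>" by auto
    then show ?case by simp
  next
    case (insert y D)
    let ?\<rho> = "\<sigma>'(y := \<sigma> y)"
    have 1: "(\<sigma>, ?\<rho>) \<in> (step F q)\<^sup>*"
      using insert.prems assms(2) by (intro insert.IH) auto
    have "comb ?\<rho> a = comb \<sigma> a"
      using insert.prems by (intro comb_cong) auto
    then have "rep F ?\<rho> q a" using assms(1) by (simp add: rep_def)
    then have "good_without F y ?\<rho> q" using insert.prems unfolding good_without_def by auto
    then have "(?\<rho>, ?\<rho>(y := \<sigma>' y)) \<in> step F q"
      using insert.prems assms(2) by (intro stepI) auto
    then have "(?\<rho>, \<sigma>') \<in> step F q" by simp
    then show ?case using 1 by (rule rtrancl_into_rtrancl[rotated])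
  qed
  moreover have D: "{x. \<sigma>' x \<noteq> \<sigma> x} \<subseteq> I - F" "\<forall>x\<in>{x. \<sigma>' x \<noteq> \<sigma> x}. a x = 0"
    using assms(4) by blast+
  moreover have "finite {x. \<sigma>' x \<noteq> \<sigma> x}"
    using D(1) finite_I by (meson finite_Diff finite_subset)
  ultimately show ?thesis using assms(3) by blast
qed

lemma step_transv: "(\<sigma>, \<sigma>') \<in> (step F q)\<^sup>* \<Longrightarrow> \<sigma> \<in> transv F \<sigma>0 \<Longrightarrow> \<sigma>' \<in> transv F \<sigma>0"
proof (induction rule: rtrancl_induct)
  case (step \<sigma>1 \<sigma>2)
  then obtain y i where "y \<in> I - F" "i < r" "\<sigma>2 = \<sigma>1(y := i)" unfolding step_def by blast
  moreover have "\<sigma>1 \<in> transv F \<sigma>0" using step.IH step.prems by blast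
  ultimately show ?case by (simp add: transv_def)
qed

lemma good_without_upd: "good_without F y (\<sigma>(y := i)) q \<longleftrightarrow> good_without F y \<sigma> q"
proof -
  have "rep F (\<sigma>(y := i)) q a \<longleftrightarrow> rep F \<sigma> q a" if "a y = 0" for a
  proof -
    have "comb (\<sigma>(y := i)) a = comb \<sigma> a" using that by (intro comb_cong) auto
    then show ?thesis by (simp add: rep_def)
  qed
  then show ?thesis unfolding good_without_def by blast
qed

lemma sym_step: "sym (step F q)"
proof (rule symI)
  fix \<sigma> \<sigma>' assume "(\<sigma>, \<sigma>') \<in> step F q"
  then obtain y i where *: "y \<in> I - F" "i < r" "\<forall>x. \<sigma> x < r" "good_without F y \<sigma> q" "\<sigma>' = \<sigma>(y := i)"
    unfolding step_def by blast
  have "(\<sigma>(y := i), (\<sigma>(y := i))(y := \<sigma> y)) \<in> step F q"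
    using * good_without_upd[of F y \<sigma> i q] by (intro stepI) auto
  then show "(\<sigma>', \<sigma>) \<in> step F q" using * by simp
qed

lemma sym_steps: "(\<sigma>, \<sigma>') \<in> (step F q)\<^sup>* \<Longrightarrow> (\<sigma>', \<sigma>) \<in> (step F q)\<^sup>*"
  using sym_rtrancl[OF sym_step] by (rule symD)

section \<open>Vertices of the polyhedron of representations\<close>

lemma vertex_rep:
  assumes "rep F \<sigma> q a" "\<forall>x. \<sigma> x < r" "y0 \<in> I - F"
  obtains y a' where "y \<in> I - F" "rep F \<sigma> q a'" "a' y = 0" "a' y0 \<le> a y0"
proof -
  have "u y0 (\<sigma> y0) \<in> V" using u_in_V assms by auto
  then obtain b where b: "b y0 = 0" "u y0 (\<sigma> y0) = comb \<sigma> b"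
    using spanning[of \<sigma> y0] assms by blast
  \<comment> \<open>Writing the vector of \<open>y0\<close> in the basis that omits
    \<open>y0\<close> gives a linear relation with \<open>k y0 = -1\<close>. Adding a nonnegative
    multiple of it keeps the sum and does not raise the coefficient of \<open>y0\<close>.\<close>
  define k where "k x = b x - (if x = y0 then 1 else 0)" for x
  have k: "comb \<sigma> k = 0"
    unfolding k_def comb_diff using comb_unit[of y0 \<sigma>] b assms by simp
  have k0: "k y0 = -1" using b by (simp add: k_def)
  define S where "S = {x \<in> I - F. k x < 0}"
  have S: "finite S" "y0 \<in> S" using finite_I assms k0 by (auto simp: S_def)
  \<comment> \<open>Ratio test: the least ratio is the first moment at which a coefficient outside
    \<open>F\<close> drops to 0.\<close>
  define f where "f x = a x / (- k x)" for x
  define y where "y = arg_min_on f S"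
  have y: "y \<in> S" and ymin: "\<And>x. x \<in> S \<Longrightarrow> f y \<le> f x"
    using arg_min_if_finite[of S f] S arg_min_least[of S _ f] unfolding y_def by auto
  define a' where "a' x = a x + f y * k x" for x
  have ky: "k y < 0" using y by (simp add: S_def)
  have fy: "f y \<ge> 0" using y assms(1) unfolding f_def S_def rep_def
    by (auto intro: divide_nonneg_neg)
  have "comb \<sigma> a' = q" unfolding a'_def comb_axpy using k assms(1) by (simp add: rep_def)
  moreover have "0 \<le> a' x" if x: "x \<in> I - F" for x
  proof (cases "k x < 0")
    case True
    then have "f y \<le> a x / (- k x)" using ymin[of x] x by (simp add: S_def f_def)
    then have "f y * (- k x) \<le> a x" using True by (simp add: field_simps)
    then show ?thesis by (simp add: a'_def)
  next
    case False
    then show ?thesis using fy assms(1) x by (auto simp: a'_def rep_def)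
  qed
  ultimately have "rep F \<sigma> q a'" by (simp add: rep_def)
  moreover have "a' y = 0" using ky by (simp add: a'_def f_def)
  moreover have "a' y0 \<le> a y0" using fy k0 by (simp add: a'_def)
  ultimately show ?thesis using that y by (auto simp: S_def)
qed

lemma good_vertex:
  assumes "good F \<sigma> q" "\<forall>x. \<sigma> x < r" "F \<subset> I"
  obtains y where "y \<in> I - F" "good_without F y \<sigma> q"
proof -
  obtain y0 where "y0 \<in> I - F" using assms by blast
  then show ?thesis using assms vertex_rep that unfolding good_def good_without_def by metis
qed

section \<open>Segments off a flat and cones covering the space\<close>

lemma vector_not_flat:
  assumes "x \<in> I - F" "y \<in> I - F" "x \<noteq> y" "\<forall>z. \<sigma> z < r" "i < r"
  shows "u x i \<notin> flat F \<sigma>"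
proof
  assume "u x i \<in> flat F \<sigma>"
  then obtain a where a: "\<forall>z\<in>I - F. a z = 0" "u x i = comb \<sigma> a" unfolding flat_def by blast
  let ?\<sigma> = "\<sigma>(x := i)"
  \<comment> \<open>This relation lives on \<open>F\<close> and \<open>x\<close>, which omit
    \<open>y\<close>, so independence applies and contradicts the coefficient -1 at
    \<open>x\<close>.\<close>
  define b where "b z = a z - (if z = x then 1 else 0)" for z
  have "comb ?\<sigma> a = comb \<sigma> a" using a assms by (intro comb_cong) auto
  then have "comb ?\<sigma> b = 0"
    unfolding b_def comb_diff using comb_unit[of x ?\<sigma>] a assms by simp
  moreover have "\<forall>z. ?\<sigma> z < r" "b y = 0" using assms a by (auto simp: b_def)
  ultimately have "b x = 0" using independence[of ?\<sigma> y b x] assms by blast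
  then show False using a assms by (simp add: b_def)
qed

text \<open>A segment that meets the flat does so strictly inside, which puts
  \<open>k i *\<^sub>R q + u x i\<close> into the flat for some \<open>k i > 0\<close>. If this
  happened for every \<open>i\<close>, summing would cancel the class and leave a positive multiple
  of \<open>q\<close> in the flat.\<close>

lemma segment_avoiding_flat:
  assumes "x \<in> I - F" "y \<in> I - F" "x \<noteq> y" "\<forall>z. \<sigma> z < r" "q \<in> V" "q \<notin> flat F \<sigma>"
  obtains i where "i < r" "\<And>s. 0 \<le> s \<Longrightarrow> s \<le> 1 \<Longrightarrow> (1 - s) *\<^sub>R q + s *\<^sub>R u x i \<notin> flat F \<sigma>"
proof (rule ccontr)
  assume "\<not> thesis"
  with that have *: "\<exists>s. 0 \<le> s \<and> s \<le> 1 \<and> (1 - s) *\<^sub>R q + s *\<^sub>R u x i \<in> flat F \<sigma>" if "i < r" for i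
    using \<open>i < r\<close> by blast
  note S = subspace_flat[of F \<sigma>]
  have "\<exists>k>0. k *\<^sub>R q + u x i \<in> flat F \<sigma>" if i: "i < r" for i
  proof -
    obtain s where s: "0 \<le> s" "s \<le> 1" "(1 - s) *\<^sub>R q + s *\<^sub>R u x i \<in> flat F \<sigma>"
      using *[OF i] by blast
    have "s \<noteq> 0" using s assms by auto
    moreover have "s \<noteq> 1" using s vector_not_flat[OF assms(1-4) i] by auto
    ultimately have "0 < s" "s < 1" using s by auto
    have "(1 / s) *\<^sub>R ((1 - s) *\<^sub>R q + s *\<^sub>R u x i) \<in> flat F \<sigma>"
      using subspace_scale[OF S s(3)] .
    then have "((1 - s) / s) *\<^sub>R q + u x i \<in> flat F \<sigma>"
      using \<open>0 < s\<close> by (simp add: scaleR_add_right)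
    then show ?thesis using \<open>0 < s\<close> \<open>s < 1\<close> by (intro exI[of _ "(1 - s) / s"]) auto
  qed
  then obtain k where k: "\<And>i. i < r \<Longrightarrow> k i > 0 \<and> k i *\<^sub>R q + u x i \<in> flat F \<sigma>" by metis
  have "(\<Sum>i<r. k i *\<^sub>R q + u x i) \<in> flat F \<sigma>"
    using k by (intro subspace_sum[OF S]) auto
  moreover have "(\<Sum>i<r. k i *\<^sub>R q + u x i) = (\<Sum>i<r. k i) *\<^sub>R q"
    using class_sum[of x] assms by (simp add: sum.distrib scaleR_sum_left)
  moreover have r0: "{..<r} \<noteq> {}" using assms(4) by (metis lessThan_iff empty_iff)
  have "(\<Sum>i<r. k i) > 0" using r0 k by (intro sum_pos) auto
  ultimately have "(1 / (\<Sum>i<r. k i)) *\<^sub>R ((\<Sum>i<r. k i) *\<^sub>R q) \<in> flat F \<sigma>"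
    using subspace_scale[OF S] by metis
  then show False using assms \<open>(\<Sum>i<r. k i) > 0\<close> by simp
qed

text \<open>A form of the colourful Caratheodory theorem modulo the span of \<open>F\<close>. A
  point moves from a vector \<open>c\<close> of another class to \<open>q\<close>. At the last
  covered time the face \<open>\<tau>\<close> supporting it is kept, and induction modulo
  \<open>F \<union> \<tau>\<close> supplies a cone containing the direction \<open>q - c\<close>,
  which carries the point further.\<close>

lemma cone_exists:
  assumes "F \<subseteq> I" "y \<in> I - F" "\<forall>x. \<sigma> x < r" "q \<in> V"
  shows "\<exists>\<sigma>'. (\<forall>x. \<sigma>' x < r) \<and> (\<forall>x. x \<notin> I - F - {y} \<longrightarrow> \<sigma>' x = \<sigma> x) \<and> good_without F y \<sigma>' q"
  using assms
proof (induction "card (I - F)" arbitrary: F \<sigma> q rule: less_induct)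
  case less
  note y = \<open>y \<in> I - F\<close> and s = \<open>\<forall>x. \<sigma> x < r\<close>
  show ?case
  proof (cases "q \<in> flat F \<sigma>")
    case True
    then obtain a where "\<forall>x\<in>I - F. a x = 0" "q = comb \<sigma> a" unfolding flat_def by blast
    then have "good_without F y \<sigma> q" unfolding good_without_def rep_def using y by (intro exI[of _ a]) auto
    then show ?thesis using s by blast
  next
    case False
    \<comment> \<open>If \<open>y\<close> were the only class outside \<open>F\<close>, the flat
      would contain all of \<open>V\<close>.\<close>
    have "I - F \<noteq> {y}"
    proof
      assume *: "I - F = {y}"
      obtain a where "a y = 0" "q = comb \<sigma> a" using spanning[OF s, of y q] less.prems by blast
      then show False using False * unfolding flat_def by auto
    qed
    then obtain x1 where x1: "x1 \<in> I - F" "x1 \<noteq> y" using y by blast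
    obtain i0 where i0: "i0 < r"
      "\<And>t. 0 \<le> t \<Longrightarrow> t \<le> 1 \<Longrightarrow> (1 - t) *\<^sub>R q + t *\<^sub>R u x1 i0 \<notin> flat F \<sigma>"
      using segment_avoiding_flat[of x1 F y \<sigma> q] x1 y s less.prems False by blast
    define c where "c = u x1 i0"
    have cV: "c \<in> V" using u_in_V x1 i0 by (simp add: c_def)
    define p where "p t = c + t *\<^sub>R (q - c)" for t :: real
    have dV: "q - c \<in> V" using subspace_diff[OF subspace_V] less.prems cV by blast
    define Tr where "Tr = transv (F \<union> {y}) \<sigma>"
    have Tr: "\<sigma>' \<in> Tr \<longleftrightarrow> (\<forall>x. \<sigma>' x < r) \<and> (\<forall>x. x \<notin> I - F - {y} \<longrightarrow> \<sigma>' x = \<sigma> x)" for \<sigma>'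
      unfolding Tr_def transv_def by (auto simp: Diff_insert2[symmetric])
    define S where "S = (\<Union>\<sigma>'\<in>Tr. {t\<in>{0..1}. good_without F y \<sigma>' (p t)})"
    have "closed {t\<in>{0..1}. good_without F y \<sigma>' (p t)}" if "\<sigma>' \<in> Tr" for \<sigma>'
    proof -
      have s': "\<forall>x. \<sigma>' x < r" using that Tr by blast
      obtain a where a: "a y = 0" "c = comb \<sigma>' a" using spanning[OF s', of y c] cV y by blast
      obtain b where b: "b y = 0" "q - c = comb \<sigma>' b" using spanning[OF s', of y "q - c"] dV y by blast
      \<comment> \<open>Coefficients vanishing at \<open>y\<close> are unique and hence affine in
        \<open>t\<close>, so the covered times are cut out by finitely many closed
        conditions.\<close>
      have "good_without F y \<sigma>' (p t) \<longleftrightarrow> (\<forall>x\<in>I - F. 0 \<le> a x + t * b x)" for t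
      proof
        assume "good_without F y \<sigma>' (p t)"
        then obtain e where e: "rep F \<sigma>' (p t) e" "e y = 0" unfolding good_without_def by blast
        have "comb \<sigma>' e = comb \<sigma>' (\<lambda>x. a x + t * b x)"
          unfolding comb_axpy using e a b by (simp add: rep_def p_def)
        then have "e x = a x + t * b x" if "x \<in> I" for x
          using unique_rep[OF s', of y e "\<lambda>x. a x + t * b x" x] e(2) a b y that by simp
        then show "\<forall>x\<in>I - F. 0 \<le> a x + t * b x" using e(1) unfolding rep_def by (metis DiffD1)
      next
        assume "\<forall>x\<in>I - F. 0 \<le> a x + t * b x"
        then show "good_without F y \<sigma>' (p t)" unfolding good_without_def rep_def p_def
          using a b by (intro exI[of _ "\<lambda>x. a x + t * b x"]) (simp add: comb_axpy)
      qed
      moreover have "closed ({0..1} \<inter> (\<Inter>x\<in>I - F. {t. 0 \<le> a x + t * b x}))"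
        by (intro closed_Int closed_INT ballI closed_Collect_le continuous_intros closed_atLeastAtMost)
      moreover have "{t\<in>{0..1}. \<forall>x\<in>I - F. 0 \<le> a x + t * b x}
          = {0..1} \<inter> (\<Inter>x\<in>I - F. {t. 0 \<le> a x + t * b x})" by auto
      ultimately show ?thesis by simp
    qed
    then have "closed S" unfolding S_def Tr_def using finite_transv by (intro closed_UN) auto
    moreover have "0 \<in> S"
    proof -
      let ?\<sigma> = "\<sigma>(x1 := i0)"
      have "?\<sigma> \<in> Tr" unfolding Tr using s i0 x1 by auto
      moreover have "good_without F y ?\<sigma> (p 0)" unfolding good_without_def rep_def
        using comb_unit[of x1 ?\<sigma>] x1
        by (intro exI[of _ "\<lambda>x. if x = x1 then 1 else 0"]) (auto simp: p_def c_def)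
      ultimately show ?thesis unfolding S_def by auto
    qed
    moreover have "bdd_above S" unfolding S_def by (auto intro!: bdd_aboveI[of _ 1])
    ultimately have SupS: "Sup S \<in> S" by (intro closed_contains_Sup) auto
    define t where "t = Sup S"
    obtain \<sigma>' where \<sigma>': "\<sigma>' \<in> Tr" "0 \<le> t" "t \<le> 1" "good_without F y \<sigma>' (p t)"
      using SupS unfolding S_def t_def by auto
    have s': "\<forall>x. \<sigma>' x < r" using \<sigma>' Tr by blast
    obtain a where a: "rep F \<sigma>' (p t) a" "a y = 0" using \<sigma>' unfolding good_without_def by blast
    have "t = 1"
    proof (rule ccontr)
      assume "t \<noteq> 1"
      define \<tau> where "\<tau> = {x \<in> I - F. a x > 0}"
      have a0: "a x = 0" if "x \<in> I" "x \<notin> F \<union> \<tau>" for x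
        using a that unfolding rep_def \<tau>_def by force
      \<comment> \<open>An empty face would place the point on the flat, which the segment
        avoids.\<close>
      have "\<tau> \<noteq> {}"
      proof
        assume "\<tau> = {}"
        have "p t = comb \<sigma>' a" using a by (simp add: rep_def)
        also have "\<dots> = comb \<sigma> a" using a0 \<open>\<tau> = {}\<close> \<sigma>'(1) Tr by (intro comb_cong) blast
        finally have "p t \<in> flat F \<sigma>" unfolding flat_def using a0 \<open>\<tau> = {}\<close> by blast
        moreover have "p t = (1 - (1 - t)) *\<^sub>R q + (1 - t) *\<^sub>R u x1 i0"
          by (simp add: p_def c_def algebra_simps)
        ultimately show False using i0(2)[of "1 - t"] \<sigma>' by simp
      qed
      then have "card (I - (F \<union> \<tau>)) < card (I - F)"
        using finite_I by (intro psubset_card_mono) (auto simp: \<tau>_def)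
      then obtain \<sigma>2 where \<sigma>2: "\<forall>x. \<sigma>2 x < r" "\<forall>x. x \<notin> I - (F \<union> \<tau>) - {y} \<longrightarrow> \<sigma>2 x = \<sigma>' x"
          "good_without (F \<union> \<tau>) y \<sigma>2 (q - c)"
        using less.hyps[of "F \<union> \<tau>" \<sigma>' "q - c"] less.prems s' dV a(2) by (auto simp: \<tau>_def)
      obtain b where b: "rep (F \<union> \<tau>) \<sigma>2 (q - c) b" "b y = 0"
        using \<sigma>2 unfolding good_without_def by blast
      have "finite \<tau>" "\<forall>x\<in>\<tau>. a x > 0" using finite_I by (auto simp: \<tau>_def)
      then obtain \<delta> where \<delta>: "\<delta> > 0" "\<And>x t. x \<in> \<tau> \<Longrightarrow> \<bar>t\<bar> \<le> \<delta> \<Longrightarrow> a x + t * b x > 0"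
        using affine_pos_eventually[of \<tau> a b] by blast
      define e where "e = min \<delta> (1 - t)"
      have e: "e > 0" "t + e \<le> 1" "\<bar>e\<bar> \<le> \<delta>" using \<delta> \<open>t \<noteq> 1\<close> \<sigma>' by (auto simp: e_def)
      have "comb \<sigma>2 a = comb \<sigma>' a" using a0 \<sigma>2(2) by (intro comb_cong) blast
      then have "p (t + e) = comb \<sigma>2 (\<lambda>x. a x + e * b x)"
        unfolding comb_axpy using a(1) b(1) by (simp add: rep_def p_def algebra_simps)
      \<comment> \<open>On \<open>\<tau>\<close> positivity survives a short move; off
        \<open>F \<union> \<tau>\<close> the coefficient is 0 now and moves in a nonnegative
        direction.\<close>
      moreover have "0 \<le> a x + e * b x" if "x \<in> I - F" for x
      proof (cases "x \<in> \<tau>")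
        case True
        then show ?thesis using \<delta>(2)[of x e] e by simp
      next
        case False
        then show ?thesis using a0[of x] b(1) that e(1) by (auto simp: rep_def)
      qed
      ultimately have "good_without F y \<sigma>2 (p (t + e))" unfolding good_without_def rep_def
        using a(2) b(2) by (intro exI[of _ "\<lambda>x. a x + e * b x"]) auto
      moreover have "\<sigma>2 \<in> Tr" using \<sigma>2 \<sigma>'(1) unfolding Tr by auto
      ultimately have "t + e \<in> S" unfolding S_def using e \<sigma>' by auto
      then have "t + e \<le> t" unfolding t_def using \<open>bdd_above S\<close> by (intro cSup_upper)
      then show False using e by simp
    qed
    then have "good_without F y \<sigma>' q" using \<sigma>'(4) by (simp add: p_def)
    then show ?thesis using \<sigma>'(1) Tr by blast
  qed
qed

text \<open>The coefficient at \<open>y\<close> has a minimum because finitely many transversals are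
  reachable and each contributes a closed set of values. Were it positive, the vector of
  \<open>y\<close> could be rewritten by \<open>cone_exists\<close> modulo the other supporting
  vectors. Trading a little of it for this combination lowers the coefficient, and only classes with
  coefficient 0 are changed.\<close>

lemma reach_without:
  assumes "F \<subseteq> I" "y \<in> I - F" "\<forall>x. \<sigma> x < r" "q \<in> V" "good F \<sigma> q"
  shows "\<exists>\<sigma>'. (\<sigma>, \<sigma>') \<in> (step F q)\<^sup>* \<and> good_without F y \<sigma>' q"
proof -
  define R where "R = {\<sigma>'. (\<sigma>, \<sigma>') \<in> (step F q)\<^sup>*}"
  have Rt: "R \<subseteq> transv F \<sigma>" unfolding R_def using step_transv[of \<sigma> _ F q \<sigma>] assms(3)
    by (auto simp: transv_def[of F \<sigma>])
  then have "finite R" using finite_transv finite_subset by blast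
  define S where "S = (\<Union>\<sigma>'\<in>R. {v. \<exists>a. rep F \<sigma>' q a \<and> a y = v})"
  have "closed {v. \<exists>a. rep F \<sigma>' q a \<and> a y = v}" if "\<sigma>' \<in> R" for \<sigma>'
  proof -
    have s': "\<forall>x. \<sigma>' x < r" using that Rt transvD by blast
    have "u y (\<sigma>' y) \<in> V" using u_in_V assms s' by auto
    then obtain b where b: "b y = 0" "u y (\<sigma>' y) = comb \<sigma>' b" using spanning[OF s', of y] assms by blast
    obtain a where a: "a y = 0" "q = comb \<sigma>' a" using spanning[OF s', of y q] assms by blast
    \<comment> \<open>The relation \<open>k\<close> generates all relations among the chosen
      vectors, so the representations form a line parametrised by the coefficient at
      \<open>y\<close>.\<close>
    define k where "k x = (if x = y then 1 else 0) - b x" for x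
    have k: "comb \<sigma>' k = 0" "k y = 1"
      unfolding k_def comb_diff using comb_unit[of y \<sigma>'] b assms by auto
    have "(\<exists>e. rep F \<sigma>' q e \<and> e y = v) \<longleftrightarrow> (\<forall>x\<in>I - F. 0 \<le> a x + v * k x)" for v
    proof
      assume "\<exists>e. rep F \<sigma>' q e \<and> e y = v"
      then obtain e where e: "rep F \<sigma>' q e" "e y = v" by blast
      define e' where "e' x = e x + (- v) * k x" for x
      have "comb \<sigma>' e' = comb \<sigma>' a" "e' y = 0"
        unfolding e'_def comb_axpy using k e a by (auto simp: rep_def)
      then have "e' x = a x" if "x \<in> I" for x
        using unique_rep[OF s', of y e' a x] a assms that by auto
      then have "e x = a x + v * k x" if "x \<in> I" for x
        using that unfolding e'_def by (simp add: algebra_simps)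
      then show "\<forall>x\<in>I - F. 0 \<le> a x + v * k x" using e(1) unfolding rep_def by (metis DiffD1)
    next
      assume "\<forall>x\<in>I - F. 0 \<le> a x + v * k x"
      then show "\<exists>e. rep F \<sigma>' q e \<and> e y = v" unfolding rep_def
        using a k by (intro exI[of _ "\<lambda>x. a x + v * k x"]) (simp add: comb_axpy)
    qed
    moreover have "closed (\<Inter>x\<in>I - F. {v. 0 \<le> a x + v * k x})"
      by (intro closed_INT ballI closed_Collect_le continuous_intros)
    moreover have "{v. \<forall>x\<in>I - F. 0 \<le> a x + v * k x} = (\<Inter>x\<in>I - F. {v. 0 \<le> a x + v * k x})" by auto
    ultimately show ?thesis by simp
  qed
  then have "closed S" unfolding S_def using \<open>finite R\<close> by (intro closed_UN) auto
  moreover have "S \<noteq> {}" using assms(5) unfolding S_def R_def good_def by blast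
  moreover have bdd: "bdd_below S" using assms(2) unfolding S_def rep_def by (auto intro!: bdd_belowI[of _ 0])
  ultimately have "Inf S \<in> S" by (intro closed_contains_Inf) auto
  then obtain \<sigma>' a where \<sigma>': "\<sigma>' \<in> R" and a: "rep F \<sigma>' q a" "a y = Inf S" unfolding S_def by blast
  have s': "\<forall>x. \<sigma>' x < r" using \<sigma>' Rt transvD by blast
  have "a y = 0"
  proof (rule ccontr)
    assume "a y \<noteq> 0"
    then have ay: "a y > 0" using a(1) assms(2) unfolding rep_def by force
    define \<tau> where "\<tau> = {x \<in> I - F. a x > 0}"
    have a0: "a x = 0" if "x \<in> I" "x \<notin> F \<union> \<tau>" for x
      using a that unfolding rep_def \<tau>_def by force
    \<comment> \<open>\<open>y\<close> lies in \<open>\<tau>\<close> but has to act as the omitted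
      class of \<open>cone_exists\<close>; its vector is kept, since that lemma never changes the
      value at \<open>y\<close>.\<close>
    define G where "G = F \<union> \<tau> - {y}"
    have "u y (\<sigma>' y) \<in> V" using u_in_V assms s' by auto
    then obtain \<sigma>2 where \<sigma>2: "\<forall>x. \<sigma>2 x < r" "\<forall>x. x \<notin> I - G - {y} \<longrightarrow> \<sigma>2 x = \<sigma>' x"
      "good_without G y \<sigma>2 (u y (\<sigma>' y))"
      using cone_exists[of G y \<sigma>' "u y (\<sigma>' y)"] assms s' by (auto simp: G_def \<tau>_def)
    obtain b where b: "rep G \<sigma>2 (u y (\<sigma>' y)) b" "b y = 0" using \<sigma>2 unfolding good_without_def by blast
    define k where "k x = b x - (if x = y then 1 else 0)" for x
    have y2: "\<sigma>2 y = \<sigma>' y" using \<sigma>2 by blast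
    have k: "comb \<sigma>2 k = 0" "k y = -1"
      unfolding k_def comb_diff using comb_unit[of y \<sigma>2] b assms y2 by (auto simp: rep_def)
    have "finite \<tau>" "\<forall>x\<in>\<tau>. a x > 0" using finite_I by (auto simp: \<tau>_def)
    then obtain \<delta> where \<delta>: "\<delta> > 0" "\<And>x t. x \<in> \<tau> \<Longrightarrow> \<bar>t\<bar> \<le> \<delta> \<Longrightarrow> a x + t * k x > 0"
      using affine_pos_eventually[of \<tau> a k] by blast
    have y\<tau>: "y \<in> \<tau>" using ay assms(2) by (simp add: \<tau>_def)
    have differ: "x \<in> I - F \<and> x \<notin> \<tau>" if "\<sigma>2 x \<noteq> \<sigma>' x" for x
      using \<sigma>2(2) that y\<tau> y2 unfolding G_def by blast
    then have differ0: "x \<in> I - F \<and> a x = 0" if "\<sigma>2 x \<noteq> \<sigma>' x" for x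
      using that a0 by blast
    have "comb \<sigma>2 a = comb \<sigma>' a" using differ0 by (intro comb_cong) blast
    then have "q = comb \<sigma>2 (\<lambda>x. a x + \<delta> * k x)"
      unfolding comb_axpy using a(1) k by (simp add: rep_def)
    moreover have "0 \<le> a x + \<delta> * k x" if "x \<in> I - F" for x
    proof (cases "x \<in> \<tau>")
      case True
      then show ?thesis using \<delta>(2)[of x \<delta>] \<delta>(1) by simp
    next
      case False
      then show ?thesis using a0[of x] b(1) that \<delta>(1) y\<tau> by (auto simp: rep_def k_def G_def)
    qed
    ultimately have "rep F \<sigma>2 q (\<lambda>x. a x + \<delta> * k x)" by (simp add: rep_def)
    moreover have "(\<sigma>', \<sigma>2) \<in> (step F q)\<^sup>*"
      using change_free[OF a(1) s' \<sigma>2(1)] differ0 by blast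
    then have "\<sigma>2 \<in> R" using \<sigma>' unfolding R_def by auto
    ultimately have "a y + \<delta> * k y \<in> S" unfolding S_def by blast
    then have "Inf S \<le> a y + \<delta> * k y" using bdd by (rule cInf_lower)
    then show False using a(2) k(2) \<delta>(1) by simp
  qed
  then have "good_without F y \<sigma>' q" using a(1) unfolding good_without_def by blast
  then show ?thesis using \<sigma>' unfolding R_def by blast
qed

section \<open>Moving the target vector\<close>

definition connected_at :: "'c set \<Rightarrow> ('c \<Rightarrow> nat) \<Rightarrow> 'v \<Rightarrow> bool" where
  "connected_at F \<sigma>0 q \<longleftrightarrow> (\<forall>\<sigma>\<in>transv F \<sigma>0. \<forall>\<sigma>'\<in>transv F \<sigma>0.
     good F \<sigma> q \<longrightarrow> good F \<sigma>' q \<longrightarrow> (\<sigma>, \<sigma>') \<in> (step F q)\<^sup>*)"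

text \<open>\<open>near F \<sigma>0 q q'\<close> is what remains of ``\<open>q'\<close> is close to \<open>q\<close>'' for the combinatorics: no strict sign
  of a coefficient at \<open>q\<close> is lost at \<open>q'\<close>, whereas zero coefficients may take any sign.\<close>

definition near :: "'c set \<Rightarrow> ('c \<Rightarrow> nat) \<Rightarrow> 'v \<Rightarrow> 'v \<Rightarrow> bool" where
  "near F \<sigma>0 q q' \<longleftrightarrow>
     (\<forall>\<sigma>\<in>transv F \<sigma>0. \<forall>y\<in>I. \<forall>a b. a y = 0 \<longrightarrow> b y = 0 \<longrightarrow> q = comb \<sigma> a \<longrightarrow> q' = comb \<sigma> b \<longrightarrow>
        (\<forall>x\<in>I. (0 < a x \<longrightarrow> 0 < b x) \<and> (a x < 0 \<longrightarrow> b x < 0))) \<and>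
     (\<forall>\<sigma>\<in>transv F \<sigma>0. (\<exists>a. q = comb \<sigma> a \<and> (\<forall>x\<in>I - F. 0 < a x)) \<longrightarrow> good F \<sigma> q')"

lemma nearD:
  assumes "near F \<sigma>0 q q'" "\<sigma> \<in> transv F \<sigma>0" "y \<in> I" "a y = 0" "b y = 0" "q = comb \<sigma> a" "q' = comb \<sigma> b" "x \<in> I"
  shows "0 < a x \<Longrightarrow> 0 < b x" "a x < 0 \<Longrightarrow> b x < 0"
  using assms unfolding near_def by blast+

lemma near_goodI:
  "near F \<sigma>0 q q' \<Longrightarrow> \<sigma> \<in> transv F \<sigma>0 \<Longrightarrow> q = comb \<sigma> a \<Longrightarrow> (\<And>x. x \<in> I - F \<Longrightarrow> 0 < a x) \<Longrightarrow> good F \<sigma> q'"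
  unfolding near_def by blast

text \<open>The combinatorial form of closedness of cones: a negative coefficient at
  \<open>q\<close> would still be negative at \<open>q'\<close>.\<close>

lemma near_good_without:
  assumes "near F \<sigma>0 q q'" "\<sigma> \<in> transv F \<sigma>0" "y \<in> I" "q \<in> V" "good_without F y \<sigma> q'"
  shows "good_without F y \<sigma> q"
proof -
  obtain b where b: "rep F \<sigma> q' b" "b y = 0" using assms unfolding good_without_def by blast
  obtain a where a: "a y = 0" "q = comb \<sigma> a" using spanning[OF transvD, OF assms(2,3,4)] by blast
  have "0 \<le> a x" if x: "x \<in> I - F" for x
  proof (rule ccontr)
    assume "\<not> 0 \<le> a x"
    then have "b x < 0"
      using nearD(2)[of F \<sigma>0 q q' \<sigma> y a b x] assms(1-3) a b x by (simp add: rep_def)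
    then show False using b(1) x unfolding rep_def by (meson not_le)
  qed
  then show ?thesis using a unfolding good_without_def rep_def by blast
qed

section \<open>Stars of the face that carries the target\<close>

lemma transv_mono: "\<sigma> \<in> transv F \<sigma>0 \<Longrightarrow> F \<subseteq> G \<Longrightarrow> transv G \<sigma> \<subseteq> transv F \<sigma>0"
  unfolding transv_def by auto

lemma flat_transv:
  assumes "\<sigma> \<in> transv F \<sigma>0" "F \<subseteq> I"
  shows "flat F \<sigma> = flat F \<sigma>0"
proof -
  have "comb \<sigma> a = comb \<sigma>0 a" if "\<forall>x\<in>I - F. a x = 0" for a
    using that assms by (intro comb_cong) (auto simp: transv_def)
  then have "((\<forall>x\<in>I - F. a x = 0) \<and> v = comb \<sigma> a) \<longleftrightarrow> ((\<forall>x\<in>I - F. a x = 0) \<and> v = comb \<sigma>0 a)" for a v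
    by metis
  then show ?thesis unfolding flat_def by simp
qed

text \<open>The star of the face \<open>\<tau>\<close> supporting \<open>q\<close> consists of the
  transversals that keep \<open>\<tau>\<close>. By \<open>cone_exists\<close> modulo
  \<open>F \<union> \<tau>\<close>, one of them represents \<open>q'\<close> with nonnegative
  coefficients off \<open>F \<union> \<tau>\<close>; those on \<open>\<tau>\<close> are positive by
  nearness.\<close>

lemma near_star_nonempty:
  assumes "near F \<sigma>0 q q'" "\<sigma> \<in> transv F \<sigma>0" "F \<subseteq> I" "y \<in> I - F" "q' \<in> V" "rep F \<sigma> q a" "a y = 0"
  obtains \<rho> where "\<rho> \<in> transv F \<sigma>0" "\<And>x. x \<in> I - F \<Longrightarrow> 0 < a x \<Longrightarrow> \<rho> x = \<sigma> x" "good F \<rho> q'"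
proof -
  define \<tau> where "\<tau> = {x \<in> I - F. a x > 0}"
  have s: "\<forall>x. \<sigma> x < r" using assms(2) transvD by blast
  obtain \<rho> where \<rho>: "\<forall>x. \<rho> x < r" "\<forall>x. x \<notin> I - (F \<union> \<tau>) - {y} \<longrightarrow> \<rho> x = \<sigma> x"
    "good_without (F \<union> \<tau>) y \<rho> q'"
    using cone_exists[of "F \<union> \<tau>" y \<sigma> q'] assms s by (auto simp: \<tau>_def)
  obtain b where b: "rep (F \<union> \<tau>) \<rho> q' b" "b y = 0" using \<rho> unfolding good_without_def by blast
  have a0: "a x = 0" if "x \<in> I" "x \<notin> F \<union> \<tau>" for x
    using assms(6) that unfolding rep_def \<tau>_def by force
  have "comb \<rho> a = comb \<sigma> a" using \<rho>(2) a0 by (intro comb_cong) blast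
  then have q: "q = comb \<rho> a" using assms(6) by (simp add: rep_def)
  have "\<rho> \<in> transv (F \<union> \<tau>) \<sigma>" using \<rho>(1,2) unfolding transv_def by blast
  then have R: "\<rho> \<in> transv F \<sigma>0" using transv_mono[OF assms(2)] by blast
  have "0 \<le> b x" if "x \<in> I - F" for x
  proof (cases "x \<in> \<tau>")
    case True
    then show ?thesis
      using nearD(1)[of F \<sigma>0 q q' \<rho> y a b x] assms(1,4,7) R b q by (force simp: rep_def \<tau>_def)
  qed (use b(1) that in \<open>auto simp: rep_def\<close>)
  then have "good F \<rho> q'" using b(1) unfolding good_def rep_def by blast
  then show ?thesis using that R \<rho>(2) unfolding \<tau>_def by blast
qed

text \<open>Modulo \<open>F \<union> \<tau>\<close> the star is governed by the induction
  hypothesis, which applies because \<open>q\<close> off the flat makes \<open>\<tau>\<close>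
  nonempty. The path found there is also a path for \<open>F\<close>: at each exchange, in the basis
  omitting the exchanged class, nearness keeps the coefficients on \<open>\<tau>\<close>
  positive.\<close>

lemma near_star_connected:
  assumes "near F \<sigma>0 q q'" "\<sigma> \<in> transv F \<sigma>0" "F \<subseteq> I" "y \<in> I - F" "q \<notin> flat F \<sigma>0" "rep F \<sigma> q a" "a y = 0"
    and IH: "\<And>G. F \<subset> G \<Longrightarrow> G \<subset> I \<Longrightarrow> connected_at G \<sigma> q'"
    and \<rho>: "\<rho> \<in> transv F \<sigma>0" "\<And>x. x \<in> I - F \<Longrightarrow> 0 < a x \<Longrightarrow> \<rho> x = \<sigma> x" "good F \<rho> q'"
    and \<rho>': "\<rho>' \<in> transv F \<sigma>0" "\<And>x. x \<in> I - F \<Longrightarrow> 0 < a x \<Longrightarrow> \<rho>' x = \<sigma> x" "good F \<rho>' q'"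
  shows "(\<rho>, \<rho>') \<in> (step F q')\<^sup>*"
proof -
  define \<tau> where "\<tau> = {x \<in> I - F. a x > 0}"
  let ?G = "F \<union> \<tau>"
  have a0: "a x = 0" if "x \<in> I" "x \<notin> F \<union> \<tau>" for x
    using assms(6) that unfolding rep_def \<tau>_def by force
  have "\<tau> \<noteq> {}"
  proof
    assume "\<tau> = {}"
    then have "q \<in> flat F \<sigma>" using a0 assms(6) unfolding flat_def rep_def by blast
    then show False using assms(5) flat_transv[OF assms(2,3)] by simp
  qed
  then have "F \<subset> ?G" "?G \<subset> I" using assms(3,4,7) by (auto simp: \<tau>_def)
  then have "connected_at ?G \<sigma> q'" by (rule IH)
  have agree: "\<theta> \<in> transv ?G \<sigma>"
    if W: "\<theta> \<in> transv F \<sigma>0" and ag: "\<And>x. x \<in> I - F \<Longrightarrow> 0 < a x \<Longrightarrow> \<theta> x = \<sigma> x" for \<theta>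
  proof -
    have "\<theta> x = \<sigma> x" if "x \<notin> I - ?G" for x
    proof (cases "x \<in> I - F")
      case True
      then show ?thesis using \<open>x \<notin> I - ?G\<close> ag
        unfolding \<tau>_def by blast
    next
      case False
      then show ?thesis using W assms(2) unfolding transv_def by simp
    qed
    then show ?thesis using transvD[OF W] unfolding transv_def by blast
  qed
  have weaker: "good ?G \<theta> q'" if "good F \<theta> q'" for \<theta>
    using that unfolding good_def rep_def by auto
  have path: "(\<rho>, \<rho>') \<in> (step ?G q')\<^sup>*"
    using \<open>connected_at ?G \<sigma> q'\<close> agree \<rho> \<rho>' weaker unfolding connected_at_def by blast
  have "(\<rho>, \<theta>) \<in> (step F q')\<^sup>* \<and> \<theta> \<in> transv ?G \<sigma>" if "(\<rho>, \<theta>) \<in> (step ?G q')\<^sup>*" for \<theta>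
    using that
  proof (induction rule: rtrancl_induct)
    case base
    then show ?case using agree \<rho> by blast
  next
    case (step \<theta> \<theta>')
    then obtain z i where zi: "z \<in> I - ?G" "i < r" "\<forall>x. \<theta> x < r" "good_without ?G z \<theta> q'" "\<theta>' = \<theta>(z := i)"
      unfolding step_def by blast
    obtain b where b: "rep ?G \<theta> q' b" "b z = 0" using zi unfolding good_without_def by blast
    have W: "\<theta> \<in> transv F \<sigma>0" using step.IH transv_mono[OF assms(2)] by blast
    have "comb \<theta> a = comb \<sigma> a" using step.IH a0 unfolding transv_def by (intro comb_cong) blast
    then have q: "q = comb \<theta> a" using assms(6) by (simp add: rep_def)
    have "a z = 0" using a0 zi by blast
    have "0 \<le> b x" if "x \<in> I - F" for x
    proof (cases "x \<in> \<tau>")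
      case True
      then show ?thesis
        using nearD(1)[of F \<sigma>0 q q' \<theta> z a b x] assms(1) W b q \<open>a z = 0\<close> zi(1) by (force simp: rep_def \<tau>_def)
    qed (use b(1) that in \<open>auto simp: rep_def\<close>)
    then have "good_without F z \<theta> q'" using b unfolding good_without_def rep_def by blast
    then have "(\<theta>, \<theta>') \<in> step F q'" using zi stepI[of z F i \<theta> q'] by simp
    moreover have "\<theta>' \<in> transv ?G \<sigma>" using step_transv[of \<theta> \<theta>' ?G q' \<sigma>] step.IH step.hyps(2) by blast
    ultimately show ?case using step.IH by (meson rtrancl.rtrancl_into_rtrancl)
  qed
  then show ?thesis using path by blast
qed

text \<open>A step at \<open>q'\<close> is a step at \<open>q\<close> by closedness of cones. Each
  transversal good at \<open>q\<close> reaches one good at \<open>q'\<close> by changing classes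
  with coefficient 0 only, because the star of its face has a member good at
  \<open>q'\<close>.\<close>

lemma near_connected_backward:
  assumes near: "near F \<sigma>0 q q'" and "F \<subset> I" "q \<in> V" "q' \<in> V"
    and conn: "connected_at F \<sigma>0 q'"
  shows "connected_at F \<sigma>0 q"
proof -
  have *: "\<exists>\<rho>\<in>transv F \<sigma>0. good F \<rho> q' \<and> (\<sigma>, \<rho>) \<in> (step F q)\<^sup>*"
    if S: "\<sigma> \<in> transv F \<sigma>0" and g: "good F \<sigma> q" for \<sigma>
  proof -
    have s: "\<forall>x. \<sigma> x < r" using that transvD by blast
    obtain y where y: "y \<in> I - F" "good_without F y \<sigma> q" using good_vertex[OF g s assms(2)] .
    then obtain a where a: "rep F \<sigma> q a" "a y = 0" unfolding good_without_def by blast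
    obtain \<rho> where \<rho>: "\<rho> \<in> transv F \<sigma>0" "\<And>x. x \<in> I - F \<Longrightarrow> 0 < a x \<Longrightarrow> \<rho> x = \<sigma> x" "good F \<rho> q'"
      using near_star_nonempty[OF near S _ y(1) assms(4) a] assms(2) by blast
    have "x \<in> I - F \<and> a x = 0" if "\<rho> x \<noteq> \<sigma> x" for x
    proof -
      have "x \<in> I - F" using that \<rho>(1) S unfolding transv_def by force
      then show ?thesis using \<rho>(2)[of x] that a(1) unfolding rep_def by force
    qed
    then have "(\<sigma>, \<rho>) \<in> (step F q)\<^sup>*" using change_free[OF a(1) s transvD[OF \<rho>(1)]] by blast
    then show ?thesis using \<rho> by blast
  qed
  have lift: "(\<rho>, \<rho>') \<in> (step F q)\<^sup>*" if "(\<rho>, \<rho>') \<in> (step F q')\<^sup>*" "\<rho> \<in> transv F \<sigma>0" for \<rho> \<rho>'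
    using that
  proof (induction rule: rtrancl_induct)
    case (step \<theta> \<theta>')
    then have W: "\<theta> \<in> transv F \<sigma>0" using step_transv by blast
    obtain z i where zi: "z \<in> I - F" "i < r" "\<forall>x. \<theta> x < r" "good_without F z \<theta> q'" "\<theta>' = \<theta>(z := i)"
      using step.hyps(2) unfolding step_def by blast
    then have "good_without F z \<theta> q" using near_good_without[OF near W] assms by blast
    then have "(\<theta>, \<theta>') \<in> step F q" using zi stepI[of z F i \<theta> q] by simp
    then show ?case using step by auto
  qed simp
  show ?thesis unfolding connected_at_def
  proof (intro ballI impI)
    fix \<sigma> \<sigma>' assume "\<sigma> \<in> transv F \<sigma>0" "\<sigma>' \<in> transv F \<sigma>0" "good F \<sigma> q" "good F \<sigma>' q"
    then obtain \<rho> \<rho>' where r: "\<rho> \<in> transv F \<sigma>0" "good F \<rho> q'" "(\<sigma>, \<rho>) \<in> (step F q)\<^sup>*"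
      "\<rho>' \<in> transv F \<sigma>0" "good F \<rho>' q'" "(\<sigma>', \<rho>') \<in> (step F q)\<^sup>*" using * by meson
    then have "(\<rho>, \<rho>') \<in> (step F q)\<^sup>*" using lift conn unfolding connected_at_def by blast
    then show "(\<sigma>, \<sigma>') \<in> (step F q)\<^sup>*" using r sym_steps by (meson rtrancl_trans)
  qed
qed

text \<open>A step at \<open>q\<close> need not be a step at \<open>q'\<close>, so a path at
  \<open>q\<close> is followed by stars instead. An exchange leaves the face that justifies it in
  place, so both ends share its star, and stars are connected at \<open>q'\<close>.\<close>

lemma near_connected_forward:
  assumes near: "near F \<sigma>0 q q'" and F: "F \<subset> I" and "q \<in> V" "q' \<in> V" "q \<notin> flat F \<sigma>0"
    and IH: "\<And>G \<sigma>. F \<subset> G \<Longrightarrow> G \<subset> I \<Longrightarrow> \<sigma> \<in> transv F \<sigma>0 \<Longrightarrow> connected_at G \<sigma> q'"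
    and conn: "connected_at F \<sigma>0 q"
  shows "connected_at F \<sigma>0 q'"
  unfolding connected_at_def
proof (intro ballI impI)
  have FI: "F \<subseteq> I" using F by blast
  have good_back: "\<exists>y a. y \<in> I - F \<and> rep F \<sigma> q a \<and> a y = 0" if "\<sigma> \<in> transv F \<sigma>0" "good F \<sigma> q'" for \<sigma>
    using good_vertex[OF that(2) transvD[OF that(1)] F] near_good_without[OF near that(1)] assms(3)
    unfolding good_without_def by (metis DiffD1)
  fix \<rho>0 \<rho>1 assume \<rho>0: "\<rho>0 \<in> transv F \<sigma>0" "good F \<rho>0 q'" and \<rho>1: "\<rho>1 \<in> transv F \<sigma>0" "good F \<rho>1 q'"
  have "(\<rho>0, \<rho>1) \<in> (step F q)\<^sup>*"
    using conn \<rho>0 \<rho>1 good_back unfolding connected_at_def good_def by meson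
  \<comment> \<open>Invariant along the path at \<open>q\<close>: for every proper face of
    \<open>\<sigma>\<close> carrying \<open>q\<close>, all members of its star that are good at
    \<open>q'\<close> are reachable from \<open>\<rho>0\<close> by steps at
    \<open>q'\<close>.\<close>
  moreover define Q where "Q \<sigma> \<longleftrightarrow> (\<forall>y a \<rho>. y \<in> I - F \<longrightarrow> rep F \<sigma> q a \<longrightarrow> a y = 0 \<longrightarrow> \<rho> \<in> transv F \<sigma>0 \<longrightarrow>
      (\<forall>x\<in>I - F. 0 < a x \<longrightarrow> \<rho> x = \<sigma> x) \<longrightarrow> good F \<rho> q' \<longrightarrow> (\<rho>0, \<rho>) \<in> (step F q')\<^sup>*)" for \<sigma>
  have star: "(\<rho>, \<rho>') \<in> (step F q')\<^sup>*"
    if "\<sigma> \<in> transv F \<sigma>0" "y \<in> I - F" "rep F \<sigma> q a" "a y = 0"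
       "\<rho> \<in> transv F \<sigma>0" "\<forall>x\<in>I - F. 0 < a x \<longrightarrow> \<rho> x = \<sigma> x" "good F \<rho> q'"
       "\<rho>' \<in> transv F \<sigma>0" "\<forall>x\<in>I - F. 0 < a x \<longrightarrow> \<rho>' x = \<sigma> x" "good F \<rho>' q'" for \<sigma> y a \<rho> \<rho>'
    using near_star_connected[OF near that(1) FI that(2) assms(5) that(3,4) IH[OF _ _ that(1)]] that by blast
  have "Q \<rho>0"
    unfolding Q_def using star[OF \<rho>0(1)] \<rho>0 by blast
  have "Q \<sigma> \<and> \<sigma> \<in> transv F \<sigma>0" if "(\<rho>0, \<sigma>) \<in> (step F q)\<^sup>*" for \<sigma>
    using that
  proof (induction rule: rtrancl_induct)
    case base
    then show ?case using \<open>Q \<rho>0\<close> \<rho>0 by blast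
  next
    case (step \<sigma> \<sigma>')
    then obtain y i where yi: "y \<in> I - F" "i < r" "\<forall>x. \<sigma> x < r" "good_without F y \<sigma> q" "\<sigma>' = \<sigma>(y := i)"
      unfolding step_def by blast
    then obtain a where a: "rep F \<sigma> q a" "a y = 0" unfolding good_without_def by blast
    have S: "\<sigma> \<in> transv F \<sigma>0" using step.IH by blast
    have S': "\<sigma>' \<in> transv F \<sigma>0" using step_transv[of \<sigma> \<sigma>' F q \<sigma>0] step.hyps(2) S by blast
    have "comb \<sigma>' a = comb \<sigma> a" using a yi by (intro comb_cong) auto
    then have a': "rep F \<sigma>' q a" using a by (simp add: rep_def)
    have "\<sigma>' x = \<sigma> x" if "0 < a x" for x
      using a(2) yi(5) that by auto
    then have same: "(\<forall>x\<in>I - F. 0 < a x \<longrightarrow> \<rho> x = \<sigma>' x) \<longleftrightarrow> (\<forall>x\<in>I - F. 0 < a x \<longrightarrow> \<rho> x = \<sigma> x)" for \<rho> :: "'c \<Rightarrow> nat"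
      by metis
    have Qa: "(\<rho>0, \<rho>) \<in> (step F q')\<^sup>*"
      if "\<rho> \<in> transv F \<sigma>0" "\<forall>x\<in>I - F. 0 < a x \<longrightarrow> \<rho> x = \<sigma>' x" "good F \<rho> q'" for \<rho>
      using step.IH yi(1) a that same[of \<rho>] unfolding Q_def by blast
    have "Q \<sigma>'" unfolding Q_def
    proof (intro allI impI)
      fix z b \<rho>
      assume z: "z \<in> I - F" and b: "rep F \<sigma>' q b" "b z = 0"
        and \<rho>: "\<rho> \<in> transv F \<sigma>0" "\<forall>x\<in>I - F. 0 < b x \<longrightarrow> \<rho> x = \<sigma>' x" "good F \<rho> q'"
      show "(\<rho>0, \<rho>) \<in> (step F q')\<^sup>*"
      \<comment> \<open>Two faces of \<open>\<sigma>'\<close> may carry \<open>q\<close>. With a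
        common zero class the representations coincide. Otherwise their mean is positive outside
        \<open>F\<close>, so \<open>q\<close> is interior to the cone, and \<open>\<sigma>'\<close>
        itself is good at \<open>q'\<close> and links the two stars.\<close>
      proof (cases "\<exists>x\<in>I - F. b x = 0 \<and> a x = 0")
        case True
        then obtain x where x: "x \<in> I - F" "b x = 0" "a x = 0" by blast
        have "a w = b w" if "w \<in> I" for w
          using unique_rep[OF transvD[OF S'], of x a b w] x a' b(1) that by (simp add: rep_def)
        then show ?thesis using Qa \<rho> by force
      next
        case False
        have "q = comb \<sigma>' (\<lambda>x. (1/2) * (a x + b x))"
          unfolding comb_scale comb_add using a' b(1) scaleR_half_double[of q] unfolding rep_def by metis
        moreover have "0 < (1/2) * (a x + b x)" if "x \<in> I - F" for x
        proof -
          have "0 \<le> a x" "0 \<le> b x" using a' b(1) that unfolding rep_def by blast+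
          moreover have "b x \<noteq> 0 \<or> a x \<noteq> 0" using False that by blast
          ultimately show ?thesis by auto
        qed
        ultimately have "good F \<sigma>' q'" using near_goodI[OF near S', of "\<lambda>x. (1/2) * (a x + b x)"] by blast
        then have "(\<rho>0, \<sigma>') \<in> (step F q')\<^sup>*" using Qa S' by blast
        moreover have "(\<sigma>', \<rho>) \<in> (step F q')\<^sup>*"
          using star[OF S' z b S' _ \<open>good F \<sigma>' q'\<close> \<rho>] by blast
        ultimately show ?thesis by (rule rtrancl_trans)
      qed
    qed
    then show ?case using S' by blast
  qed
  ultimately have "Q \<rho>1" by blast
  moreover obtain y a where "y \<in> I - F" "rep F \<rho>1 q a" "a y = 0" using good_back[OF \<rho>1] by blast
  ultimately show "(\<rho>0, \<rho>1) \<in> (step F q')\<^sup>*" using \<rho>1 unfolding Q_def by blast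
qed

text \<open>Only strict inequalities between coefficients affine in \<open>t\<close> have to
  persist, for finitely many transversals.\<close>

lemma eventually_near:
  assumes "p \<in> V" "d \<in> V" "F \<subset> I"
  shows "\<forall>\<^sub>F t in nhds (0::real). near F \<sigma>0 p (p + t *\<^sub>R d)"
proof -
  have ev: "\<forall>\<^sub>F t in nhds (0::real). \<forall>x\<in>T. 0 < a x + t * b x" if pos: "finite T" "\<forall>x\<in>T. 0 < a x" for T and a b :: "'c \<Rightarrow> real"
  proof -
    obtain \<delta> where "\<delta> > 0" "\<And>x t. x \<in> T \<Longrightarrow> \<bar>t\<bar> \<le> \<delta> \<Longrightarrow> a x + t * b x > 0"
      using affine_pos_eventually[OF pos, of b] by blast
    then have "\<forall>t. dist t 0 < \<delta> \<longrightarrow> (\<forall>x\<in>T. 0 < a x + t * b x)"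
      by (simp add: dist_real_def less_imp_le)
    then show ?thesis unfolding eventually_nhds_metric using \<open>\<delta> > 0\<close> by blast
  qed
  have 1: "\<forall>\<^sub>F t in nhds (0::real). \<forall>a b. a y = 0 \<longrightarrow> b y = 0 \<longrightarrow> p = comb \<sigma> a \<longrightarrow> p + t *\<^sub>R d = comb \<sigma> b \<longrightarrow>
        (\<forall>x\<in>I. (0 < a x \<longrightarrow> 0 < b x) \<and> (a x < 0 \<longrightarrow> b x < 0))" if "\<sigma> \<in> transv F \<sigma>0" "y \<in> I" for \<sigma> y
  proof -
    have s: "\<forall>x. \<sigma> x < r" using that transvD by blast
    obtain a where a: "a y = 0" "p = comb \<sigma> a" using spanning[OF s \<open>y \<in> I\<close> assms(1)] by blast
    obtain b where b: "b y = 0" "d = comb \<sigma> b" using spanning[OF s \<open>y \<in> I\<close> assms(2)] by blast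
    have "\<forall>\<^sub>F t in nhds (0::real). (\<forall>x\<in>{x\<in>I. 0 < a x}. 0 < a x + t * b x) \<and>
          (\<forall>x\<in>{x\<in>I. 0 < - a x}. 0 < - a x + t * (- b x))"
      using finite_I by (intro eventually_conj ev) auto
    then show ?thesis
    proof eventually_elim
      case (elim t)
      show ?case
      proof (intro allI impI ballI)
        fix a' b' x assume *: "a' y = 0" "b' y = 0" "p = comb \<sigma> a'" "p + t *\<^sub>R d = comb \<sigma> b'" "x \<in> I"
        have "comb \<sigma> b' = comb \<sigma> (\<lambda>x. a x + t * b x)" unfolding comb_axpy using * a b by simp
        then have "b' x = a x + t * b x"
          using unique_rep[OF s, of y b' "\<lambda>x. a x + t * b x" x] * a b that by simp
        moreover have "a' x = a x" using unique_rep[OF s, of y a' a x] * a that by simp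
        ultimately show "(0 < a' x \<longrightarrow> 0 < b' x) \<and> (a' x < 0 \<longrightarrow> b' x < 0)" using elim * by force
      qed
    qed
  qed
  have 2: "\<forall>\<^sub>F t in nhds (0::real). (\<exists>a. p = comb \<sigma> a \<and> (\<forall>x\<in>I - F. 0 < a x)) \<longrightarrow> good F \<sigma> (p + t *\<^sub>R d)"
    if S: "\<sigma> \<in> transv F \<sigma>0" for \<sigma>
  proof (cases "\<exists>a. p = comb \<sigma> a \<and> (\<forall>x\<in>I - F. 0 < a x)")
    case True
    then obtain a where a: "p = comb \<sigma> a" "\<forall>x\<in>I - F. 0 < a x" by blast
    obtain y where "y \<in> I" using assms by blast
    then obtain b where b: "d = comb \<sigma> b" using spanning[OF transvD[OF S], of y d] assms by blast
    have "\<forall>\<^sub>F t in nhds (0::real). \<forall>x\<in>I - F. 0 < a x + t * b x" using a finite_I by (intro ev) auto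
    then show ?thesis
    proof eventually_elim
      case (elim t)
      have "rep F \<sigma> (p + t *\<^sub>R d) (\<lambda>x. a x + t * b x)"
        unfolding rep_def comb_axpy using a b elim by (auto intro: less_imp_le)
      then show ?case unfolding good_def by blast
    qed
  qed auto
  have "\<forall>\<^sub>F t in nhds (0::real). (\<forall>\<sigma>\<in>transv F \<sigma>0. \<forall>y\<in>I. \<forall>a b. a y = 0 \<longrightarrow> b y = 0 \<longrightarrow> p = comb \<sigma> a \<longrightarrow> p + t *\<^sub>R d = comb \<sigma> b \<longrightarrow>
        (\<forall>x\<in>I. (0 < a x \<longrightarrow> 0 < b x) \<and> (a x < 0 \<longrightarrow> b x < 0))) \<and>
     (\<forall>\<sigma>\<in>transv F \<sigma>0. (\<exists>a. p = comb \<sigma> a \<and> (\<forall>x\<in>I - F. 0 < a x)) \<longrightarrow> good F \<sigma> (p + t *\<^sub>R d))"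
    using 1 2 finite_transv finite_I
    by (intro eventually_conj eventually_ball_finite ballI) auto
  then show ?thesis unfolding near_def .
qed

text \<open>Once class \<open>x1\<close> is free it can be set to \<open>i0\<close>. The target is
  then its own representation, with coefficient 0 at all other classes, which may be changed at
  will.\<close>

lemma connected_at_vector:
  assumes "x1 \<in> I - F" "i0 < r" "F \<subseteq> I"
  shows "connected_at F \<sigma>0 (u x1 i0)"
  unfolding connected_at_def
proof (intro ballI impI)
  let ?c = "u x1 i0"
  have cV: "?c \<in> V" using u_in_V assms by blast
  have *: "\<exists>\<rho>\<in>transv F \<sigma>0. \<rho> x1 = i0 \<and> (\<sigma>, \<rho>) \<in> (step F ?c)\<^sup>*"
    if S: "\<sigma> \<in> transv F \<sigma>0" "good F \<sigma> ?c" for \<sigma>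
  proof -
    obtain \<sigma>' where \<sigma>': "(\<sigma>, \<sigma>') \<in> (step F ?c)\<^sup>*" "good_without F x1 \<sigma>' ?c"
      using reach_without[OF assms(3,1) transvD[OF S(1)] cV S(2)] by blast
    then have "\<forall>x. \<sigma>' x < r" using step_transv S transvD by blast
    then have "(\<sigma>', \<sigma>'(x1 := i0)) \<in> step F ?c" using \<sigma>' assms stepI by blast
    then have "(\<sigma>, \<sigma>'(x1 := i0)) \<in> (step F ?c)\<^sup>*" using \<sigma>' by (meson rtrancl.rtrancl_into_rtrancl)
    then show ?thesis using step_transv S(1) by (metis fun_upd_same)
  qed
  fix \<sigma> \<sigma>' assume "\<sigma> \<in> transv F \<sigma>0" "\<sigma>' \<in> transv F \<sigma>0" "good F \<sigma> ?c" "good F \<sigma>' ?c"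
  then obtain \<rho> \<rho>' where r: "\<rho> \<in> transv F \<sigma>0" "\<rho> x1 = i0" "(\<sigma>, \<rho>) \<in> (step F ?c)\<^sup>*"
      "\<rho>' \<in> transv F \<sigma>0" "\<rho>' x1 = i0" "(\<sigma>', \<rho>') \<in> (step F ?c)\<^sup>*" using * by meson
  have "rep F \<rho> ?c (\<lambda>x. if x = x1 then 1 else 0)"
    unfolding rep_def using comb_unit[of x1 \<rho>] assms r by auto
  moreover have "x \<in> I - F \<and> (if x = x1 then 1 else (0::real)) = 0" if "\<rho>' x \<noteq> \<rho> x" for x
    using that r unfolding transv_def by (cases "x \<in> I - F") auto
  ultimately have "(\<rho>, \<rho>') \<in> (step F ?c)\<^sup>*"
    using change_free[of F \<rho> ?c _ \<rho>'] transvD r by blast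
  then show "(\<sigma>, \<sigma>') \<in> (step F ?c)\<^sup>*" using r sym_steps by (meson rtrancl_trans)
qed

text \<open>Along a segment off the flat connectedness is locally constant, hence constant on the
  whole interval, and it holds at the end, which is a vector of some class. The induction hypothesis
  serves to connect the stars of nonempty faces.\<close>

theorem always_connected:
  assumes "F \<subset> I" "\<forall>x. \<sigma>0 x < r" "q \<in> V"
  shows "connected_at F \<sigma>0 q"
  using assms
proof (induction "card (I - F)" arbitrary: F \<sigma>0 q rule: less_induct)
  case less
  show ?case
  proof (cases "q \<in> flat F \<sigma>0")
    case True
    \<comment> \<open>On the flat all coefficients outside \<open>F\<close> can be taken to be 0, so
      every class there is free.\<close>
    then obtain a where a: "\<forall>x\<in>I - F. a x = 0" "q = comb \<sigma>0 a" unfolding flat_def by blast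
    show ?thesis unfolding connected_at_def
    proof (intro ballI impI)
      fix \<sigma> \<sigma>' assume s: "\<sigma> \<in> transv F \<sigma>0" "\<sigma>' \<in> transv F \<sigma>0"
      have "comb \<sigma> a = comb \<sigma>0 a" using a s by (intro comb_cong) (auto simp: transv_def)
      then have "rep F \<sigma> q a" using a by (simp add: rep_def)
      moreover have "x \<in> I - F \<and> a x = 0" if "\<sigma>' x \<noteq> \<sigma> x" for x
        using that s a(1) unfolding transv_def by (cases "x \<in> I - F") auto
      ultimately show "(\<sigma>, \<sigma>') \<in> (step F q)\<^sup>*"
        using change_free transvD[OF s(1)] transvD[OF s(2)] by blast
    qed
  next
    case False
    note s = \<open>\<forall>x. \<sigma>0 x < r\<close>
    obtain y where y: "y \<in> I - F" using less.prems by blast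
    have "I - F \<noteq> {y}"
    proof
      assume *: "I - F = {y}"
      obtain a where "a y = 0" "q = comb \<sigma>0 a" using spanning[OF s, of y q] less.prems y by blast
      then show False using False * unfolding flat_def by auto
    qed
    then obtain x1 where x1: "x1 \<in> I - F" "x1 \<noteq> y" using y by blast
    obtain i0 where i0: "i0 < r"
      "\<And>t. 0 \<le> t \<Longrightarrow> t \<le> 1 \<Longrightarrow> (1 - t) *\<^sub>R q + t *\<^sub>R u x1 i0 \<notin> flat F \<sigma>0"
      using segment_avoiding_flat[of x1 F y \<sigma>0 q] x1 y s less.prems False by blast
    define c where "c = u x1 i0"
    have cV: "c \<in> V" using u_in_V x1 i0 by (simp add: c_def)
    have dV: "c - q \<in> V" using subspace_diff[OF subspace_V] less.prems cV by blast
    define p where "p t = q + t *\<^sub>R (c - q)" for t :: real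
    have pV: "p t \<in> V" for t
      unfolding p_def using subspace_add[OF subspace_V] subspace_scale[OF subspace_V] less.prems(3) dV by blast
    have IH: "connected_at G \<sigma> q'" if "F \<subset> G" "G \<subset> I" "\<sigma> \<in> transv F \<sigma>0" "q' \<in> V" for G \<sigma> q'
    proof (rule less.hyps)
      show "card (I - G) < card (I - F)" using that finite_I by (intro psubset_card_mono) auto
    qed (use that transvD in auto)
    have "connected_at F \<sigma>0 (p 0) = connected_at F \<sigma>0 (p 1)"
    proof (rule connected_local_const[of "{0..1::real}"])
      show "\<forall>s\<in>{0..1}. \<forall>\<^sub>F t in at s within {0..1}. connected_at F \<sigma>0 (p s) = connected_at F \<sigma>0 (p t)"
      proof
        fix s :: real assume s01: "s \<in> {0..1}"
        have "p s = (1 - s) *\<^sub>R q + s *\<^sub>R u x1 i0" by (simp add: p_def c_def algebra_simps)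
        then have nf: "p s \<notin> flat F \<sigma>0" using i0(2)[of s] s01 by simp
        have "\<forall>\<^sub>F t in nhds (0::real). near F \<sigma>0 (p s) (p s + t *\<^sub>R (c - q))"
          using eventually_near pV dV less.prems by blast
        then have "\<forall>\<^sub>F t in nhds s. near F \<sigma>0 (p s) (p s + (t - s) *\<^sub>R (c - q))"
          by (simp add: eventually_nhds_metric dist_real_def) (metis add_diff_cancel_left')
        moreover have "p s + (t - s) *\<^sub>R (c - q) = p t" for t by (simp add: p_def algebra_simps)
        ultimately have "\<forall>\<^sub>F t in nhds s. near F \<sigma>0 (p s) (p t)" by simp
        then have "\<forall>\<^sub>F t in nhds s. connected_at F \<sigma>0 (p s) = connected_at F \<sigma>0 (p t)"
        proof eventually_elim
          case (elim t)
          show ?case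
            using near_connected_forward[OF elim less.prems(1) pV pV nf IH]
              near_connected_backward[OF elim less.prems(1) pV pV] pV by blast
        qed
        then show "\<forall>\<^sub>F t in at s within {0..1}. connected_at F \<sigma>0 (p s) = connected_at F \<sigma>0 (p t)"
          by (simp add: eventually_at_filter eventually_mono)
      qed
    qed auto
    moreover have "p 0 = q" "p 1 = c" by (auto simp: p_def)
    moreover have "connected_at F \<sigma>0 c" unfolding c_def using connected_at_vector x1 i0 less.prems by blast
    ultimately show ?thesis by simp
  qed
qed

end

section \<open>Transversals capturing the origin\<close>

text \<open>The origin lies in the convex hull of the chosen vectors, written as a nontrivial
  nonnegative relation so that coefficients can be rescaled freely.\<close>

definition captures :: "('c \<Rightarrow> nat \<Rightarrow> 'v::real_vector) \<Rightarrow> 'c set \<Rightarrow> ('c \<Rightarrow> nat) \<Rightarrow> bool" where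
  "captures u X \<sigma> \<longleftrightarrow> (\<exists>a. (\<forall>x\<in>X. 0 \<le> a x) \<and> (\<exists>x\<in>X. a x \<noteq> 0) \<and> (\<Sum>x\<in>X. a x *\<^sub>R u x (\<sigma> x)) = 0)"

definition moves :: "('c \<Rightarrow> nat \<Rightarrow> 'v::real_vector) \<Rightarrow> nat \<Rightarrow> 'c set \<Rightarrow> (('c \<Rightarrow> nat) \<times> ('c \<Rightarrow> nat)) set" where
  "moves u r X = {(\<sigma>, \<sigma>(y := i)) | \<sigma> y i. y \<in> X \<and> i < r \<and> (\<forall>x. \<sigma> x < r) \<and> captures u (X - {y}) \<sigma>}"

lemma movesI:
  "y \<in> X \<Longrightarrow> i < r \<Longrightarrow> \<forall>x. \<sigma> x < r \<Longrightarrow> captures u (X - {y}) \<sigma> \<Longrightarrow> (\<sigma>, \<sigma>(y := i)) \<in> moves u r X"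
  unfolding moves_def by blast

lemma captures_cong:
  assumes "\<And>x. x \<in> X \<Longrightarrow> \<sigma> x = \<sigma>' x"
  shows "captures u X \<sigma> = captures u X \<sigma>'"
proof -
  have "(\<Sum>x\<in>X. a x *\<^sub>R u x (\<sigma> x)) = (\<Sum>x\<in>X. a x *\<^sub>R u x (\<sigma>' x))" for a
    using assms by (intro sum.cong) auto
  then show ?thesis unfolding captures_def by simp
qed

lemma captures_mono:
  assumes "captures u Y \<sigma>" "Y \<subseteq> X" "finite X"
  shows "captures u X \<sigma>"
proof -
  obtain a where a: "\<forall>x\<in>Y. 0 \<le> a x" "\<exists>x\<in>Y. a x \<noteq> 0" "(\<Sum>x\<in>Y. a x *\<^sub>R u x (\<sigma> x)) = 0"
    using assms(1) unfolding captures_def by blast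
  define b where "b x = (if x \<in> Y then a x else 0)" for x
  have "(\<Sum>x\<in>X. b x *\<^sub>R u x (\<sigma> x)) = (\<Sum>x\<in>Y. a x *\<^sub>R u x (\<sigma> x))"
    by (rule sum.mono_neutral_cong_right) (use assms in \<open>auto simp: b_def\<close>)
  then show ?thesis unfolding captures_def using a assms(2) by (intro exI[of _ b]) (auto simp: b_def)
qed

text \<open>The target is \<open>- u y (\<sigma> y)\<close>, represented without \<open>y\<close>;
  the vector of \<open>y\<close> with coefficient 1 then completes a nontrivial relation.\<close>

lemma (in generic_classes) captures_exists:
  assumes "\<forall>x. \<sigma> x < r" "I \<noteq> {}"
  shows "\<exists>\<rho>. (\<forall>x. \<rho> x < r) \<and> (\<forall>x. x \<notin> I \<longrightarrow> \<rho> x = \<sigma> x) \<and> captures u I \<rho>"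
proof -
  obtain y where y: "y \<in> I" using assms by blast
  have uV: "u y (\<sigma> y) \<in> V" using u_in_V assms y by blast
  then have "- u y (\<sigma> y) \<in> V" by (rule subspace_neg[OF subspace_V])
  then obtain \<rho> where \<rho>: "\<forall>x. \<rho> x < r" "\<forall>x. x \<notin> I - {} - {y} \<longrightarrow> \<rho> x = \<sigma> x"
     "good_without {} y \<rho> (- u y (\<sigma> y))"
    using cone_exists[of "{}" y \<sigma> "- u y (\<sigma> y)"] y assms by blast
  then obtain a where a: "rep {} \<rho> (- u y (\<sigma> y)) a" "a y = 0" unfolding good_without_def by blast
  let ?b = "\<lambda>x. a x + (if x = y then 1 else 0)"
  have "\<rho> y = \<sigma> y" "comb \<rho> a = - u y (\<sigma> y)" using a \<rho>(2) by (auto simp: rep_def)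
  then have "comb \<rho> ?b = 0" unfolding comb_add using comb_unit[OF y, of \<rho>] by simp
  moreover have "\<forall>x\<in>I. 0 \<le> ?b x" "?b y \<noteq> 0" using a by (auto simp: rep_def)
  ultimately have "captures u I \<rho>" unfolding captures_def using y by (intro exI[of _ ?b]) blast
  then show ?thesis using \<rho> by blast
qed

text \<open>For a fixed vector of \<open>x0\<close>, capturing means that its negative lies in the
  cone of the other classes, so \<open>always_connected\<close> applies. To change the vector of
  \<open>x0\<close>, the path passes through a transversal whose other classes capture the origin by
  themselves.\<close>

lemma generic_moves_connected:
  assumes X: "finite X" "x0 \<in> X" and gen: "generic_classes u r (X - {x0}) V"
    and V0: "\<And>i. i < r \<Longrightarrow> u x0 i \<in> V" and ne: "X - {x0} \<noteq> {}"
    and s: "\<forall>x. \<sigma> x < r" "\<forall>x. \<sigma>' x < r" "\<And>x. x \<notin> X \<Longrightarrow> \<sigma> x = \<sigma>' x"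
    and c: "captures u X \<sigma>" "captures u X \<sigma>'"
  shows "(\<sigma>, \<sigma>') \<in> (moves u r X)\<^sup>*"
proof -
  interpret generic_classes u r "X - {x0}" V by (rule gen)
  let ?I = "X - {x0}"
  have split: "(\<Sum>x\<in>X. a x *\<^sub>R u x (\<rho> x)) = a x0 *\<^sub>R u x0 (\<rho> x0) + comb \<rho> a" for a and \<rho> :: "'a \<Rightarrow> nat"
    using X by (simp add: sum.remove)
  have to_good: "good {} \<rho> (- u x0 (\<rho> x0))" if r: "\<forall>x. \<rho> x < r" "captures u X \<rho>" for \<rho>
  proof -
    obtain a where a: "\<forall>x\<in>X. 0 \<le> a x" "\<exists>x\<in>X. a x \<noteq> 0" "(\<Sum>x\<in>X. a x *\<^sub>R u x (\<rho> x)) = 0"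
      using r unfolding captures_def by blast
    show ?thesis
    proof (cases "a x0 = 0")
      case False
      then have pos: "a x0 > 0" using a X by force
      have "- (a x0 *\<^sub>R u x0 (\<rho> x0)) = comb \<rho> a"
        using a split[of a \<rho>] by (metis add.commute add_eq_0_iff)
      then have "(1 / a x0) *\<^sub>R (- (a x0 *\<^sub>R u x0 (\<rho> x0))) = comb \<rho> (\<lambda>x. (1 / a x0) * a x)"
        unfolding comb_scale by simp
      then have "- u x0 (\<rho> x0) = comb \<rho> (\<lambda>x. (1 / a x0) * a x)" using pos by simp
      then have "rep {} \<rho> (- u x0 (\<rho> x0)) (\<lambda>x. (1 / a x0) * a x)"
        unfolding rep_def using a pos by auto
      then show ?thesis unfolding good_def by blast
    next
      \<comment> \<open>The relation does not involve \<open>x0\<close>. Independence makes it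
        strictly positive on the other classes, so a large multiple of it turns any representation
        into a nonnegative one.\<close>
      case True
      then have a0: "comb \<rho> a = 0" using a split[of a \<rho>] by simp
      have apos: "0 < a x" if "x \<in> ?I" for x
      proof (rule ccontr)
        assume "\<not> 0 < a x"
        then have "a x = 0" using a that by force
        then have "a z = 0" if "z \<in> ?I" for z
          using independence[OF r(1), of x a z] a0 \<open>x \<in> ?I\<close> that by blast
        then show False using a(2) True by blast
      qed
      obtain y where y: "y \<in> ?I" using ne by blast
      have "- u x0 (\<rho> x0) \<in> V" using V0 r by (intro subspace_neg[OF subspace_V]) auto
      then obtain b where b: "- u x0 (\<rho> x0) = comb \<rho> b" using spanning[OF r(1) y] by blast
      define t where "t = (\<Sum>x\<in>?I. \<bar>b x\<bar> / a x)"
      have "0 \<le> b x + t * a x" if x: "x \<in> ?I" for x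
      proof -
        have "\<bar>b x\<bar> / a x \<le> t" unfolding t_def using finite_I x apos
          by (intro member_le_sum) (auto simp: less_imp_le)
        then have "\<bar>b x\<bar> \<le> t * a x" using apos[OF x] by (simp add: field_simps)
        then show ?thesis by linarith
      qed
      then have "rep {} \<rho> (- u x0 (\<rho> x0)) (\<lambda>x. b x + t * a x)"
        unfolding rep_def comb_axpy using a0 b by auto
      then show ?thesis unfolding good_def by blast
    qed
  qed
  have lift: "(\<rho>, \<theta>) \<in> (moves u r X)\<^sup>*"
    if "(\<rho>, \<theta>) \<in> (step {} (- u x0 (\<rho> x0)))\<^sup>*" for \<rho> \<theta>
  proof -
    have "(\<rho>, \<theta>) \<in> (moves u r X)\<^sup>* \<and> \<theta> x0 = \<rho> x0"
      using that
    proof (induction rule: rtrancl_induct)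
      case (step \<theta> \<theta>')
      then obtain y i where yi: "y \<in> ?I" "i < r" "\<forall>x. \<theta> x < r" "good_without {} y \<theta> (- u x0 (\<rho> x0))" "\<theta>' = \<theta>(y := i)"
        unfolding step_def by blast
      then obtain a where a: "rep {} \<theta> (- u x0 (\<rho> x0)) a" "a y = 0" unfolding good_without_def by blast
      define b where "b x = (if x = x0 then 1 else a x)" for x
      have "comb \<theta> b = comb \<theta> a" by (intro sum.cong) (auto simp: b_def)
      moreover have "comb \<theta> a = - u x0 (\<theta> x0)" using a(1) step.IH unfolding rep_def by metis
      ultimately have "(\<Sum>x\<in>X. b x *\<^sub>R u x (\<theta> x)) = 0"
        unfolding split by (simp add: b_def)
      moreover have "(\<Sum>x\<in>X. b x *\<^sub>R u x (\<theta> x)) = (\<Sum>x\<in>X - {y}. b x *\<^sub>R u x (\<theta> x))"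
        using X a(2) yi(1) by (intro sum.mono_neutral_right) (auto simp: b_def)
      ultimately have "captures u (X - {y}) \<theta>" unfolding captures_def
        using a X yi by (intro exI[of _ b]) (auto simp: b_def rep_def)
      then have "(\<theta>, \<theta>') \<in> moves u r X" using yi by (simp add: movesI)
      moreover have "\<theta>' x0 = \<rho> x0" using step.IH yi by auto
      ultimately show ?case using step.IH by (meson rtrancl.rtrancl_into_rtrancl)
    qed simp
    then show ?thesis by blast
  qed
  have same: "(\<rho>, \<theta>) \<in> (moves u r X)\<^sup>*"
    if "\<forall>x. \<rho> x < r" "\<forall>x. \<theta> x < r" "captures u X \<rho>" "captures u X \<theta>" "\<And>x. x \<notin> ?I \<Longrightarrow> \<theta> x = \<rho> x" for \<rho> \<theta>
  proof -
    have "- u x0 (\<rho> x0) \<in> V" using V0 that by (intro subspace_neg[OF subspace_V]) auto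
    then have "connected_at {} \<rho> (- u x0 (\<rho> x0))" using always_connected ne that(1) by blast
    moreover have "\<rho> \<in> transv {} \<rho>" "\<theta> \<in> transv {} \<rho>" using that unfolding transv_def by auto
    moreover have "\<theta> x0 = \<rho> x0" using that by simp
    ultimately show ?thesis using lift to_good that(1-4) unfolding connected_at_def by metis
  qed
  obtain \<rho> where \<rho>: "\<forall>x. \<rho> x < r" "\<forall>x. x \<notin> ?I \<longrightarrow> \<rho> x = \<sigma> x" "captures u ?I \<rho>"
    using captures_exists s(1) ne by blast
  let ?\<rho> = "\<rho>(x0 := \<sigma>' x0)"
  have c': "captures u ?I ?\<rho>" using \<rho>(3) captures_cong[of ?I \<rho> ?\<rho> u] by auto
  have "(\<sigma>, \<rho>) \<in> (moves u r X)\<^sup>*"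
    using \<rho> captures_mono[OF \<rho>(3) _ X(1)] s c by (intro same) auto
  moreover have "(\<rho>, ?\<rho>) \<in> moves u r X" using \<rho> X s by (intro movesI) auto
  moreover have "(?\<rho>, \<sigma>') \<in> (moves u r X)\<^sup>*"
    using \<rho> captures_mono[OF c' _ X(1)] s c by (intro same) auto
  ultimately show ?thesis by (meson rtrancl_trans rtrancl.rtrancl_into_rtrancl)
qed

section \<open>Perturbation to general position\<close>

text \<open>Coefficients are attached to indices because \<open>f\<close> may repeat
  vectors.\<close>

lemma convex_hull_imageD:
  assumes "finite J" "y \<in> convex hull (f ` J)"
  shows "\<exists>a. (\<forall>x\<in>J. 0 \<le> a x) \<and> sum a J = 1 \<and> y = (\<Sum>x\<in>J. a x *\<^sub>R f x)"
proof -
  let ?S = "{y. \<exists>a. (\<forall>x\<in>J. 0 \<le> a x) \<and> sum a J = 1 \<and> y = (\<Sum>x\<in>J. a x *\<^sub>R f x)}"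
  have "convex hull (f ` J) \<subseteq> ?S"
  proof (rule hull_minimal)
    show "f ` J \<subseteq> ?S"
    proof safe
      fix x assume "x \<in> J"
      then show "\<exists>a. (\<forall>x\<in>J. 0 \<le> a x) \<and> sum a J = 1 \<and> f x = (\<Sum>x\<in>J. a x *\<^sub>R f x)"
        using assms by (intro exI[of _ "\<lambda>z. if z = x then 1 else 0"])
          (simp add: if_distrib[of "\<lambda>c. c *\<^sub>R _"] sum.delta cong: if_cong)
    qed
    show "convex ?S"
    proof (rule convexI)
      fix y z and s t :: real
      assume "y \<in> ?S" "z \<in> ?S" and st: "0 \<le> s" "0 \<le> t" "s + t = 1"
      then obtain a b where ab: "\<forall>x\<in>J. 0 \<le> a x" "sum a J = 1" "y = (\<Sum>x\<in>J. a x *\<^sub>R f x)"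
        "\<forall>x\<in>J. 0 \<le> b x" "sum b J = 1" "z = (\<Sum>x\<in>J. b x *\<^sub>R f x)" by blast
      let ?c = "\<lambda>x. s * a x + t * b x"
      have "sum ?c J = 1" using ab st by (simp add: sum.distrib sum_distrib_left[symmetric])
      moreover have "s *\<^sub>R y + t *\<^sub>R z = (\<Sum>x\<in>J. ?c x *\<^sub>R f x)"
        using ab by (simp add: scaleR_add_left sum.distrib scaleR_sum_right)
      moreover have "\<forall>x\<in>J. 0 \<le> ?c x" using ab st by simp
      ultimately show "s *\<^sub>R y + t *\<^sub>R z \<in> ?S" by (intro CollectI exI[of _ ?c]) simp
    qed
  qed
  then show ?thesis using assms by blast
qed

lemma captures_normalized:
  assumes "captures u X \<sigma>" "finite X"
  obtains a where "\<And>x. x \<in> X \<Longrightarrow> 0 \<le> a x" "sum a X = 1" "(\<Sum>x\<in>X. a x *\<^sub>R u x (\<sigma> x)) = 0"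
proof -
  obtain a where a: "\<forall>x\<in>X. 0 \<le> a x" "\<exists>x\<in>X. a x \<noteq> 0" "(\<Sum>x\<in>X. a x *\<^sub>R u x (\<sigma> x)) = 0"
    using assms(1) unfolding captures_def by blast
  define s where "s = sum a X"
  have "s \<noteq> 0" unfolding s_def using a assms(2) by (simp add: sum_nonneg_eq_0_iff)
  moreover have "s \<ge> 0" unfolding s_def using a by (intro sum_nonneg) auto
  ultimately have s: "s > 0" by simp
  have "(\<Sum>x\<in>X. (a x / s) *\<^sub>R u x (\<sigma> x)) = (1 / s) *\<^sub>R (\<Sum>x\<in>X. a x *\<^sub>R u x (\<sigma> x))"
    by (simp add: scaleR_sum_right)
  then show ?thesis
    using a s by (intro that[of "\<lambda>x. a x / s"]) (auto simp: sum_divide_distrib[symmetric] s_def)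
qed

text \<open>The compact hull keeps a distance \<open>d\<close> from the origin, and moving every
  vector by less than \<open>d / 2\<close> moves a convex combination by at most
  \<open>d / 2\<close>.\<close>

lemma captures_closed_single:
  fixes u :: "'c \<Rightarrow> nat \<Rightarrow> 'v::real_normed_vector"
  assumes "finite J" "\<not> captures u J \<sigma>"
  shows "\<exists>\<eta>>0. \<forall>u'. (\<forall>x\<in>J. norm (u' x (\<sigma> x) - u x (\<sigma> x)) < \<eta>) \<longrightarrow> \<not> captures u' J \<sigma>"
proof -
  let ?f = "\<lambda>x. u x (\<sigma> x)"
  have "0 \<notin> convex hull (?f ` J)"
  proof
    assume "0 \<in> convex hull (?f ` J)"
    then obtain a where a: "\<forall>x\<in>J. 0 \<le> a x" "sum a J = 1" "0 = (\<Sum>x\<in>J. a x *\<^sub>R ?f x)"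
      using convex_hull_imageD assms(1) by blast
    have "\<exists>x\<in>J. a x \<noteq> 0" using a(2) by (metis sum.neutral zero_neq_one)
    then have "captures u J \<sigma>" unfolding captures_def using a by (intro exI[of _ a]) simp
    then show False using assms(2) by simp
  qed
  moreover have "closed (convex hull (?f ` J))"
    using assms(1) by (intro compact_imp_closed finite_imp_compact_convex_hull) auto
  ultimately obtain d where d: "d > 0" "ball 0 d \<subseteq> - (convex hull (?f ` J))"
    using open_contains_ball[of "- (convex hull (?f ` J))"] by blast
  show ?thesis
  proof (intro exI[of _ "d / 2"] conjI allI impI notI)
    fix u' assume near: "\<forall>x\<in>J. norm (u' x (\<sigma> x) - u x (\<sigma> x)) < d / 2" and "captures u' J \<sigma>"
    then obtain a where a: "\<And>x. x \<in> J \<Longrightarrow> 0 \<le> a x" "sum a J = 1" "(\<Sum>x\<in>J. a x *\<^sub>R u' x (\<sigma> x)) = 0"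
      using captures_normalized assms(1) by blast
    have "(\<Sum>x\<in>J. a x *\<^sub>R ?f x) \<in> convex hull (?f ` J)"
      using a assms(1) by (intro convex_sum convex_convex_hull) (auto intro: hull_inc)
    then have "(\<Sum>x\<in>J. a x *\<^sub>R ?f x) \<notin> ball 0 d" using d(2) by blast
    then have "d \<le> norm (\<Sum>x\<in>J. a x *\<^sub>R ?f x)" by simp
    also have "(\<Sum>x\<in>J. a x *\<^sub>R ?f x) = (\<Sum>x\<in>J. a x *\<^sub>R (?f x - u' x (\<sigma> x)))"
      using a(3) by (simp add: scaleR_diff_right sum_subtractf)
    also have "norm \<dots> \<le> (\<Sum>x\<in>J. a x * (d / 2))"
    proof (intro order_trans[OF norm_sum] sum_mono)
      fix x assume x: "x \<in> J"
      then have "norm (?f x - u' x (\<sigma> x)) \<le> d / 2" using near by (simp add: norm_minus_commute less_imp_le)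
      then show "norm (a x *\<^sub>R (?f x - u' x (\<sigma> x))) \<le> a x * (d / 2)"
        using mult_left_mono[OF _ a(1)[OF x]] a(1)[OF x] by (simp only: norm_scaleR abs_of_nonneg)
    qed
    also have "\<dots> = d / 2" using a(2) by (simp only: sum_distrib_right[symmetric])
    finally show False using d(1) by linarith
  qed (use d in auto)
qed

text \<open>Up to values off \<open>X\<close> there are finitely many pairs of a subset and a
  choice, so one \<open>\<eta>\<close> serves all. What is captured after a small perturbation was
  captured before; this returns results from generic to arbitrary classes.\<close>

lemma captures_closed:
  fixes u :: "'c \<Rightarrow> nat \<Rightarrow> 'v::real_normed_vector"
  assumes "finite X"
  obtains \<eta> where "\<eta> > 0" "\<And>u' J \<sigma>. (\<And>x i. x \<in> X \<Longrightarrow> i < r \<Longrightarrow> norm (u' x i - u x i) < \<eta>) \<Longrightarrow>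
      J \<subseteq> X \<Longrightarrow> \<forall>x. \<sigma> x < r \<Longrightarrow> captures u' J \<sigma> \<Longrightarrow> captures u J \<sigma>"
proof -
  let ?T = "Pow X \<times> (X \<rightarrow>\<^sub>E {..<r})"
  have "\<exists>\<eta>>0. \<forall>u'. (\<forall>x\<in>fst p. norm (u' x (snd p x) - u x (snd p x)) < \<eta>) \<longrightarrow> captures u' (fst p) (snd p) \<longrightarrow> captures u (fst p) (snd p)"
    if "p \<in> ?T" for p
  proof (cases "captures u (fst p) (snd p)")
    case True
    then show ?thesis by (auto intro: exI[of _ 1])
  next
    case False
    have "finite (fst p)" using that assms finite_subset by auto
    from captures_closed_single[OF this False] show ?thesis by blast
  qed
  then obtain e where e: "\<And>p. p \<in> ?T \<Longrightarrow> e p > 0"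
    "\<And>p u'. p \<in> ?T \<Longrightarrow> \<forall>x\<in>fst p. norm (u' x (snd p x) - u x (snd p x)) < e p \<Longrightarrow> captures u' (fst p) (snd p) \<Longrightarrow> captures u (fst p) (snd p)"
    by metis
  have fin: "finite ?T" using assms by (intro finite_cartesian_product finite_PiE) auto
  \<comment> \<open>The inserted 1 covers the case in which there are no pairs.\<close>
  define \<eta> where "\<eta> = Min (insert 1 (e ` ?T))"
  have "\<eta> > 0" unfolding \<eta>_def using fin e(1) by (subst Min_gr_iff) auto
  moreover have le: "\<eta> \<le> e p" if "p \<in> ?T" for p
    unfolding \<eta>_def using fin that by (intro Min_le) auto
  have "captures u J \<sigma>"
    if n: "\<And>x i. x \<in> X \<Longrightarrow> i < r \<Longrightarrow> norm (u' x i - u x i) < \<eta>" and J: "J \<subseteq> X" and s: "\<forall>x. \<sigma> x < r"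
      and c: "captures u' J \<sigma>" for u' J \<sigma>
  proof -
    let ?\<rho> = "restrict \<sigma> X"
    have p: "(J, ?\<rho>) \<in> ?T" using J s by auto
    have eq: "captures w J \<sigma> = captures w J ?\<rho>" for w :: "'c \<Rightarrow> nat \<Rightarrow> 'v"
      using J by (intro captures_cong) auto
    have "norm (u' x (?\<rho> x) - u x (?\<rho> x)) < e (J, ?\<rho>)" if "x \<in> J" for x
    proof -
      have "x \<in> X" using that J by blast
      then have "norm (u' x (\<sigma> x) - u x (\<sigma> x)) < \<eta>" using n s by blast
      then show ?thesis using le[OF p] \<open>x \<in> X\<close> by simp
    qed
    then show ?thesis using e(2)[OF p, of u'] c eq by simp
  qed
  ultimately show ?thesis using that by blast
qed

section \<open>Avoiding finitely many subspaces\<close>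

lemma finite_line_hits:
  fixes v w :: "'v::real_vector"
  assumes "finite \<H>" "\<And>H. H \<in> \<H> \<Longrightarrow> subspace H" "\<And>H. H \<in> \<H> \<Longrightarrow> v \<notin> H \<or> w \<notin> H"
  shows "finite {\<delta>. \<exists>H\<in>\<H>. v + \<delta> *\<^sub>R w \<in> H}"
proof -
  have "finite {\<delta>. v + \<delta> *\<^sub>R w \<in> H}" if H: "H \<in> \<H>" for H
  proof -
    note S = assms(2)[OF H]
    have "s = t" if "v + s *\<^sub>R w \<in> H" "v + t *\<^sub>R w \<in> H" for s t
    proof (rule ccontr)
      assume "s \<noteq> t"
      have "(v + s *\<^sub>R w) - (v + t *\<^sub>R w) \<in> H" using subspace_diff[OF S] that by blast
      then have "(s - t) *\<^sub>R w \<in> H" by (simp add: algebra_simps)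
      then have "(1 / (s - t)) *\<^sub>R ((s - t) *\<^sub>R w) \<in> H" by (rule subspace_scale[OF S])
      then have w: "w \<in> H" using \<open>s \<noteq> t\<close> by simp
      then have "v + s *\<^sub>R w - s *\<^sub>R w \<in> H" using that subspace_diff[OF S] subspace_scale[OF S] by blast
      then show False using w assms(3)[OF H] by simp
    qed
    then have "{\<delta>. v + \<delta> *\<^sub>R w \<in> H} = {} \<or> (\<exists>s. {\<delta>. v + \<delta> *\<^sub>R w \<in> H} = {s})" by blast
    then show ?thesis by auto
  qed
  moreover have "{\<delta>. \<exists>H\<in>\<H>. v + \<delta> *\<^sub>R w \<in> H} = (\<Union>H\<in>\<H>. {\<delta>. v + \<delta> *\<^sub>R w \<in> H})" by blast
  ultimately show ?thesis using assms(1) by simp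
qed

lemma avoid_finite:
  fixes Z :: "real set"
  assumes "finite Z" "0 < e"
  obtains \<delta> where "0 < \<delta>" "\<delta> < e" "\<delta> \<notin> Z"
proof -
  have "infinite {0<..<e}" using assms(2) by (simp add: infinite_Ioo)
  then have "\<not> {0<..<e} \<subseteq> Z" using assms(1) finite_subset by blast
  then obtain \<delta> where "\<delta> \<in> {0<..<e}" "\<delta> \<notin> Z" by blast
  then show ?thesis using that[of \<delta>] by simp
qed

text \<open>Nonnegativity of \<open>k\<close> matters later, when the combination is absorbed into a
  relation with nonnegative coefficients. Subspaces are treated one at a time: a multiple of a
  vector outside the new one is added, and only finitely many multiples are bad.\<close>

lemma cone_avoids_subspaces:
  fixes f :: "'c \<Rightarrow> 'v::real_vector"
  assumes "finite \<H>" "finite J" "\<And>H. H \<in> \<H> \<Longrightarrow> subspace H" "\<And>H. H \<in> \<H> \<Longrightarrow> \<exists>x\<in>J. f x \<notin> H"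
  shows "\<exists>k. (\<forall>x\<in>J. 0 \<le> k x) \<and> (\<forall>H\<in>\<H>. (\<Sum>x\<in>J. k x *\<^sub>R f x) \<notin> H)"
  using assms(1,3,4)
proof (induction \<H> rule: finite_induct)
  case empty
  then show ?case by (auto intro!: exI[of _ "\<lambda>_. 0"])
next
  case (insert H \<H>)
  then obtain k where k: "\<forall>x\<in>J. 0 \<le> k x" "\<forall>H\<in>\<H>. (\<Sum>x\<in>J. k x *\<^sub>R f x) \<notin> H" by blast
  obtain y where y: "y \<in> J" "f y \<notin> H" using insert.prems(2)[of H] by auto
  have "finite {\<delta>. \<exists>H\<in>insert H \<H>. (\<Sum>x\<in>J. k x *\<^sub>R f x) + \<delta> *\<^sub>R f y \<in> H}"
    using insert k y by (intro finite_line_hits) auto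
  then obtain \<delta> :: real where \<delta>: "0 < \<delta>" "\<delta> < 1" "\<forall>H\<in>insert H \<H>. (\<Sum>x\<in>J. k x *\<^sub>R f x) + \<delta> *\<^sub>R f y \<notin> H"
    by (rule avoid_finite[where e = 1]) auto
  let ?k = "\<lambda>x. k x + \<delta> * (if x = y then 1 else 0)"
  have "(\<Sum>x\<in>J. (if x = y then 1 else 0) *\<^sub>R f x) = f y"
    using y assms(2) by (simp add: if_distrib[of "\<lambda>c. c *\<^sub>R _"] sum.delta cong: if_cong)
  then have "(\<Sum>x\<in>J. ?k x *\<^sub>R f x) = (\<Sum>x\<in>J. k x *\<^sub>R f x) + \<delta> *\<^sub>R f y"
    by (simp only: scaleR_add_left sum.distrib scaleR_scaleR[symmetric] scaleR_sum_right[symmetric])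
  then show ?case using \<delta> k(1) by (intro exI[of _ ?k]) auto
qed

section \<open>Indexed independence and general position\<close>

definition independent_family :: "'c set \<Rightarrow> ('c \<Rightarrow> 'v::real_vector) \<Rightarrow> bool" where
  "independent_family J f \<longleftrightarrow> (\<forall>a. (\<Sum>x\<in>J. a x *\<^sub>R f x) = 0 \<longrightarrow> (\<forall>x\<in>J. a x = 0))"

lemma independent_family_insert:
  assumes "finite J" "y \<notin> J" "independent_family J f" "f y \<notin> span (f ` J)"
  shows "independent_family (insert y J) f"
  unfolding independent_family_def
proof (intro allI impI)
  fix a assume *: "(\<Sum>x\<in>insert y J. a x *\<^sub>R f x) = 0"
  have sp: "(\<Sum>x\<in>J. a x *\<^sub>R f x) \<in> span (f ` J)"
    by (intro span_sum span_scale span_base) auto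
  have eq: "a y *\<^sub>R f y = - (\<Sum>x\<in>J. a x *\<^sub>R f x)"
    using * assms by (simp add: eq_neg_iff_add_eq_0)
  have ay: "a y = 0"
  proof (rule ccontr)
    assume "a y \<noteq> 0"
    then have "f y = (1 / a y) *\<^sub>R (a y *\<^sub>R f y)" by simp
    also have "\<dots> \<in> span (f ` J)" unfolding eq by (intro span_scale span_neg sp)
    finally show False using assms(4) by simp
  qed
  then have "(\<Sum>x\<in>J. a x *\<^sub>R f x) = 0" using eq by simp
  then show "\<forall>x\<in>insert y J. a x = 0" using ay assms(3) unfolding independent_family_def by blast
qed

lemma independent_family_inj:
  assumes "finite J" "independent_family J f"
  shows "inj_on f J"
proof (rule inj_onI, rule ccontr)
  fix x y assume xy: "x \<in> J" "y \<in> J" "f x = f y" "x \<noteq> y"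
  let ?a = "\<lambda>z. (if z = x then 1 else 0) - (if z = y then 1 else (0::real))"
  have "(\<Sum>z\<in>J. ?a z *\<^sub>R f z) = 0"
    using xy assms(1) by (simp add: scaleR_diff_left sum_subtractf if_distrib[of "\<lambda>c. c *\<^sub>R _"] sum.delta cong: if_cong)
  then have "\<forall>z\<in>J. ?a z = 0" using assms(2) unfolding independent_family_def by (elim allE[of _ ?a]) simp
  then have "?a x = 0" using xy by blast
  then show False using xy by simp
qed

lemma independent_family_independent:
  assumes "finite J" "independent_family J f"
  shows "independent (f ` J)"
proof -
  have inj: "inj_on f J" by (rule independent_family_inj[OF assms])
  have "c v = 0" if "(\<Sum>v\<in>f ` J. c v *\<^sub>R v) = 0" "v \<in> f ` J" for c v
  proof -
    have "(\<Sum>x\<in>J. c (f x) *\<^sub>R f x) = 0" using that(1) by (simp add: sum.reindex[OF inj])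
    then have "\<forall>x\<in>J. c (f x) = 0"
      using assms(2) unfolding independent_family_def by (elim allE[of _ "\<lambda>x. c (f x)"]) auto
    then show ?thesis using that(2) by blast
  qed
  then show ?thesis using dependent_finite[of "f ` J"] assms(1) by blast
qed

lemma independent_family_card:
  assumes "finite J" "independent_family J f" "finite S" "f ` J \<subseteq> span S"
  shows "card J \<le> card S"
  using independent_span_bound[OF assms(3) independent_family_independent[OF assms(1,2)] assms(4)]
    card_image[OF independent_family_inj[OF assms(1,2)]] by simp

text \<open>\<open>W x\<close> is a pool of vectors for class \<open>x\<close> rather than the class
  itself. Two perturbations placed in the same pools are generic jointly, so classes from both can
  be mixed.\<close>

definition general_position :: "nat \<Rightarrow> 'c set \<Rightarrow> ('c \<Rightarrow> 'v::real_vector set) \<Rightarrow> bool" where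
  "general_position N X W \<longleftrightarrow>
     (\<forall>J f. J \<subseteq> X \<longrightarrow> card J \<le> N \<longrightarrow> (\<forall>x\<in>J. f x \<in> W x) \<longrightarrow> independent_family J f)"

lemma general_positionD:
  "general_position N X W \<Longrightarrow> J \<subseteq> X \<Longrightarrow> card J \<le> N \<Longrightarrow> (\<And>x. x \<in> J \<Longrightarrow> f x \<in> W x) \<Longrightarrow> independent_family J f"
  unfolding general_position_def by blast

definition zero_sum :: "('c \<Rightarrow> nat \<Rightarrow> 'v::real_vector) \<Rightarrow> nat \<Rightarrow> 'c set \<Rightarrow> 'v set \<Rightarrow> bool" where
  "zero_sum u r X V \<longleftrightarrow> (\<forall>x\<in>X. (\<forall>i<r. u x i \<in> V) \<and> (\<Sum>i<r. u x i) = 0)"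

text \<open>The sequence space used later is infinite dimensional; the relevant dimension is that of
  \<open>span B\<close>, namely \<open>card B\<close>.\<close>

locale finite_basis =
  fixes B :: "'v::real_normed_vector set"
  assumes finite_B: "finite B" and independent_B: "independent B"
begin

text \<open>The subspaces that a new vector must avoid in order to extend every independent choice
  of fewer than \<open>card B\<close> pool vectors. The extensional function space serves
  finiteness.\<close>

definition small_spans :: "'c set \<Rightarrow> ('c \<Rightarrow> 'v set) \<Rightarrow> 'v set set" where
  "small_spans X W = {span (f ` J) | J f. J \<subseteq> X \<and> card J < card B \<and> f \<in> J \<rightarrow>\<^sub>E (\<Union>x\<in>X. W x) \<and> (\<forall>x\<in>J. f x \<in> W x)}"

lemma finite_small_spans:
  assumes "finite X" "\<And>x. x \<in> X \<Longrightarrow> finite (W x)"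
  shows "finite (small_spans X W)"
proof -
  have "small_spans X W \<subseteq> (\<Union>J\<in>Pow X. (\<lambda>f. span (f ` J)) ` (J \<rightarrow>\<^sub>E (\<Union>x\<in>X. W x)))"
    unfolding small_spans_def by blast
  moreover have "finite (\<Union>J\<in>Pow X. (\<lambda>f. span (f ` J)) ` (J \<rightarrow>\<^sub>E (\<Union>x\<in>X. W x)))"
    using assms finite_subset by (intro finite_UN_I finite_imageI finite_PiE) auto
  ultimately show ?thesis by (rule finite_subset)
qed

lemma small_spansI:
  assumes "J \<subseteq> X" "card J < card B" "\<And>x. x \<in> J \<Longrightarrow> f x \<in> W x"
  shows "span (f ` J) \<in> small_spans X W"
proof -
  have "span (f ` J) = span (restrict f J ` J)" by (metis image_restrict_eq)
  moreover have "restrict f J \<in> J \<rightarrow>\<^sub>E (\<Union>x\<in>X. W x)" using assms by auto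
  ultimately show ?thesis unfolding small_spans_def using assms by (auto intro!: exI[of _ J] exI[of _ "restrict f J"])
qed

lemma small_spans_subspace: "H \<in> small_spans X W \<Longrightarrow> subspace H"
  unfolding small_spans_def by auto

lemma not_in_small_span:
  assumes "finite X" "H \<in> small_spans X W" "finite K" "independent_family K g" "card K = card B"
  shows "\<exists>x\<in>K. g x \<notin> H"
proof (rule ccontr)
  assume *: "\<not> ?thesis"
  obtain J f where J: "H = span (f ` J)" "J \<subseteq> X" "card J < card B" using assms(2) unfolding small_spans_def by blast
  then have fJ: "finite J" using assms(1) finite_subset by blast
  have "card K \<le> card (f ` J)"
    using * J fJ by (intro independent_family_card[OF assms(3,4)]) auto
  also have "\<dots> \<le> card J" by (rule card_image_le[OF fJ])
  finally show False using J assms by simp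
qed

lemma independent_family_B: "independent_family B (\<lambda>b. b)"
  using independent_B dependent_finite[OF finite_B] unfolding independent_family_def by blast

lemma spanning_family:
  assumes "finite J" "independent_family J f" "card J = card B" "f ` J \<subseteq> span B" "v \<in> span B"
  shows "\<exists>a. v = (\<Sum>x\<in>J. a x *\<^sub>R f x)"
proof -
  have inj: "inj_on f J" by (rule independent_family_inj[OF assms(1,2)])
  have "v \<in> span (f ` J)"
  proof (rule ccontr)
    assume v: "v \<notin> span (f ` J)"
    then have "independent (insert v (f ` J))"
      using independent_family_independent[OF assms(1,2)] by (simp add: independent_insertI)
    then have "card (insert v (f ` J)) \<le> card B"
      using independent_span_bound[OF finite_B, of "insert v (f ` J)"] assms by simp
    moreover have "v \<notin> f ` J" using v span_base[of v "f ` J"] by argo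
    ultimately show False using assms card_image[OF inj] by simp
  qed
  then obtain c where "v = (\<Sum>w\<in>f ` J. c w *\<^sub>R w)" using span_finite[of "f ` J"] assms(1) by auto
  then have "v = (\<Sum>x\<in>J. c (f x) *\<^sub>R f x)" by (simp add: sum.reindex[OF inj])
  then show ?thesis by (intro exI[of _ "\<lambda>x. c (f x)"])
qed

text \<open>With one class omitted, \<open>card B\<close> independent vectors of
  \<open>span B\<close> remain, and these form a basis.\<close>

lemma general_position_generic:
  fixes u :: "'c \<Rightarrow> nat \<Rightarrow> 'v"
  assumes "finite I" "card I = card B + 1" "I \<subseteq> X" "general_position (card B) X W"
    "zero_sum u r X (span B)" "\<And>x i. x \<in> X \<Longrightarrow> i < r \<Longrightarrow> u x i \<in> W x"
  shows "generic_classes u r I (span B)"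
proof
  show "finite I" "subspace (span B)" by (auto simp: assms)
  show "u x i \<in> span B" if "x \<in> I" "i < r" for x i
    using that assms(3,5) unfolding zero_sum_def by blast
  show "(\<Sum>i<r. u x i) = 0" if "x \<in> I" for x
    using that assms(3,5) unfolding zero_sum_def by blast
  fix \<sigma> :: "'c \<Rightarrow> nat" and y assume s: "\<forall>x. \<sigma> x < r" and y: "y \<in> I"
  let ?J = "I - {y}" and ?f = "\<lambda>x. u x (\<sigma> x)"
  have J: "finite ?J" "card ?J = card B" using assms(1,2) y by auto
  have ind: "independent_family ?J ?f"
    using assms(3,6) s J by (intro general_positionD[OF assms(4)]) auto
  have drop: "(\<Sum>x\<in>I. a x *\<^sub>R ?f x) = (\<Sum>x\<in>?J. a x *\<^sub>R ?f x)" if "a y = 0" for a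
    using assms(1) y that by (simp add: sum.remove)
  show "\<exists>a. a y = 0 \<and> v = (\<Sum>x\<in>I. a x *\<^sub>R u x (\<sigma> x))" if v: "v \<in> span B" for v
  proof -
    have "?f ` ?J \<subseteq> span B" using assms(3,5) s unfolding zero_sum_def by auto
    then obtain a where a: "v = (\<Sum>x\<in>?J. a x *\<^sub>R ?f x)" using spanning_family[OF J(1) ind J(2) _ v] by blast
    have "v = (\<Sum>x\<in>?J. (a(y := 0)) x *\<^sub>R ?f x)" unfolding a by (intro sum.cong) auto
    then show ?thesis using drop[of "a(y := 0)"] by (intro exI[of _ "a(y := 0)"]) simp
  qed
  show "a x = 0" if "a y = 0" "(\<Sum>x\<in>I. a x *\<^sub>R u x (\<sigma> x)) = 0" "x \<in> I" for a x
    using that drop[of a] ind unfolding independent_family_def by (cases "x = y") auto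
qed

text \<open>The vector at \<open>p\<close> is shifted by \<open>e + \<delta> *\<^sub>R z\<close> and
  the others by \<open>-1 / (r - 1)\<close> times that, which preserves the zero sum. As
  \<open>z\<close> lies in no small span, each new vector meets each of these for at most one
  \<open>\<delta>\<close>, so all but finitely many \<open>\<delta>\<close> are admissible. The part
  \<open>e\<close> of the shift is prescribed by the caller.\<close>

lemma add_class:
  fixes t :: "nat \<Rightarrow> 'v" and \<delta>0 :: real
  assumes gp: "general_position (card B) X W" and X: "finite X" "x \<in> X"
    and W: "\<And>y. y \<in> X \<Longrightarrow> finite (W y)"
    and t: "\<And>i. i < r \<Longrightarrow> t i \<in> span B" "(\<Sum>i<r. t i) = 0" and r: "2 \<le> r" "p < r"
    and e: "e \<in> span B" "z \<in> span B" and z: "\<And>H. H \<in> small_spans (X - {x}) W \<Longrightarrow> z \<notin> H"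
    and \<delta>0: "0 < \<delta>0"
  obtains \<delta> v where "0 < \<delta>" "\<delta> < \<delta>0" "v p = t p + (e + \<delta> *\<^sub>R z)" "(\<Sum>i<r. v i) = 0"
    "\<And>i. i < r \<Longrightarrow> v i \<in> span B" "\<And>i. i < r \<Longrightarrow> norm (v i - t i) \<le> norm e + \<delta> * norm z"
    "general_position (card B) X (W(x := W x \<union> v ` {..<r}))"
proof -
  define k where "k i = (if i = p then 1 else - 1 / (real r - 1))" for i
  have k0: "k i \<noteq> 0" "\<bar>k i\<bar> \<le> 1" for i using r by (auto simp: k_def field_simps)
  have "(\<Sum>i<r. k i) = k p + (\<Sum>i\<in>{..<r} - {p}. k i)" using r by (intro sum.remove) auto
  also have "(\<Sum>i\<in>{..<r} - {p}. k i) = (\<Sum>i\<in>{..<r} - {p}. - 1 / (real r - 1))"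
    by (intro sum.cong) (auto simp: k_def)
  also have "\<dots> = -1" using r by (simp add: of_nat_diff)
  finally have ksum: "(\<Sum>i<r. k i) = 0" by (simp add: k_def)
  let ?S = "small_spans (X - {x}) W"
  have S: "finite ?S" using X W by (intro finite_small_spans) auto
  have "finite {\<delta>. \<exists>H\<in>?S. (t i + k i *\<^sub>R e) + \<delta> *\<^sub>R (k i *\<^sub>R z) \<in> H}" for i
  proof (rule finite_line_hits[OF S small_spans_subspace])
    fix H assume H: "H \<in> ?S"
    have "k i *\<^sub>R z \<notin> H"
    proof
      assume "k i *\<^sub>R z \<in> H"
      then have "(1 / k i) *\<^sub>R (k i *\<^sub>R z) \<in> H" using subspace_scale[OF small_spans_subspace[OF H]] by blast
      then show False using z[OF H] k0(1)[of i] by simp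
    qed
    then show "t i + k i *\<^sub>R e \<notin> H \<or> k i *\<^sub>R z \<notin> H" by blast
  qed
  then have "finite (\<Union>i<r. {\<delta>. \<exists>H\<in>?S. (t i + k i *\<^sub>R e) + \<delta> *\<^sub>R (k i *\<^sub>R z) \<in> H})" by simp
  from avoid_finite[OF this \<delta>0] obtain \<delta> where \<delta>: "0 < \<delta>" "\<delta> < \<delta>0"
    "\<delta> \<notin> (\<Union>i<r. {\<delta>. \<exists>H\<in>?S. (t i + k i *\<^sub>R e) + \<delta> *\<^sub>R (k i *\<^sub>R z) \<in> H})"
    by blast
  define v where "v i = t i + k i *\<^sub>R (e + \<delta> *\<^sub>R z)" for i
  have off: "v i \<notin> H" if "i < r" "H \<in> ?S" for i H
  proof -
    have "v i = (t i + k i *\<^sub>R e) + \<delta> *\<^sub>R (k i *\<^sub>R z)"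
      by (simp add: v_def scaleR_add_right mult.commute)
    then show ?thesis using \<delta>(3) that by auto
  qed
  have "general_position (card B) X (W(x := W x \<union> v ` {..<r}))"
    unfolding general_position_def
  proof (intro allI impI)
    fix J f assume J: "J \<subseteq> X" "card J \<le> card B" and f: "\<forall>y\<in>J. f y \<in> (W(x := W x \<union> v ` {..<r})) y"
    have fJ: "finite J" using J X finite_subset by blast
    show "independent_family J f"
    proof (cases "x \<in> J \<and> f x \<notin> W x")
      case False
      then show ?thesis using gp J f by (intro general_positionD[OF gp]) (auto split: if_splits)
    next
      case True
      then have "f x \<in> v ` {..<r}" using f by force
      then obtain i where i: "i < r" "f x = v i" by blast
      let ?J = "J - {x}"
      have cJ: "card ?J < card B" using True fJ J by (metis card_Diff1_less less_le_trans)
      have W': "f y \<in> W y" if "y \<in> ?J" for y using f that by (auto split: if_splits)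
      have "independent_family ?J f" using J cJ W' by (intro general_positionD[OF gp]) auto
      moreover have "f x \<notin> span (f ` ?J)"
        using off[OF i(1) small_spansI[OF _ cJ W']] J i by auto
      ultimately have "independent_family (insert x ?J) f" using fJ by (intro independent_family_insert) auto
      then show ?thesis using True by (simp add: insert_absorb)
    qed
  qed
  moreover have "(\<Sum>i<r. v i) = 0"
    unfolding v_def using t ksum by (simp add: sum.distrib scaleR_sum_left[symmetric])
  moreover have "v i \<in> span B" if "i < r" for i
    unfolding v_def using t e that by (intro span_add span_scale) auto
  moreover have "norm (v i - t i) \<le> norm e + \<delta> * norm z" for i
  proof -
    have "norm (v i - t i) = \<bar>k i\<bar> * norm (e + \<delta> *\<^sub>R z)" by (simp add: v_def)
    also have "\<dots> \<le> 1 * norm (e + \<delta> *\<^sub>R z)" using k0 by (intro mult_right_mono) auto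
    also have "\<dots> \<le> norm e + \<delta> * norm z" using norm_triangle_ineq[of e "\<delta> *\<^sub>R z"] \<delta> by simp
    finally show ?thesis .
  qed
  moreover have "v p = t p + (e + \<delta> *\<^sub>R z)" by (simp add: v_def k_def)
  ultimately show ?thesis using that \<delta> by blast
qed

lemma add_classes:
  fixes u :: "'c \<Rightarrow> nat \<Rightarrow> 'v"
  assumes "finite X" "general_position (card B) X W" "\<And>y. y \<in> X \<Longrightarrow> finite (W y)"
    and "zero_sum u r X (span B)" "2 \<le> r" "0 < \<eta>" "Y \<subseteq> X"
  shows "\<exists>u'. zero_sum u' r Y (span B) \<and> (\<forall>y\<in>Y. \<forall>i<r. norm (u' y i - u y i) < \<eta>) \<and>
     general_position (card B) X (\<lambda>y. if y \<in> Y then W y \<union> u' y ` {..<r} else W y)"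
proof -
  have "finite Y" using assms finite_subset by blast
  then show ?thesis using assms(7)
  proof (induction Y rule: finite_induct)
    case empty
    then show ?case using assms(2) by (auto simp: zero_sum_def)
  next
    case (insert x Y)
    then obtain u' where u': "zero_sum u' r Y (span B)" "\<forall>y\<in>Y. \<forall>i<r. norm (u' y i - u y i) < \<eta>"
      and gp: "general_position (card B) X (\<lambda>y. if y \<in> Y then W y \<union> u' y ` {..<r} else W y)" by auto
    let ?W = "\<lambda>y. if y \<in> Y then W y \<union> u' y ` {..<r} else W y"
    have W: "finite (?W y)" if "y \<in> X" for y using assms(3) that by auto
    have x: "x \<in> X" using insert by blast
    let ?S = "small_spans (X - {x}) ?W"
    \<comment> \<open>No small span contains all of \<open>B\<close>, so a combination of basis
      vectors yields an admissible direction.\<close>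
    have "\<exists>k. (\<forall>b\<in>B. 0 \<le> k b) \<and> (\<forall>H\<in>?S. (\<Sum>b\<in>B. k b *\<^sub>R b) \<notin> H)"
    proof (rule cone_avoids_subspaces)
      show "finite ?S" using assms(1) W by (intro finite_small_spans) auto
      show "\<exists>b\<in>B. b \<notin> H" if "H \<in> ?S" for H
        using not_in_small_span[OF _ that finite_B independent_family_B] assms(1) by auto
    qed (use finite_B small_spans_subspace in auto)
    then obtain k where k: "\<And>H. H \<in> ?S \<Longrightarrow> (\<Sum>b\<in>B. k b *\<^sub>R b) \<notin> H" by blast
    define z where "z = (\<Sum>b\<in>B. k b *\<^sub>R b)"
    have z: "z \<in> span B" unfolding z_def by (intro span_sum span_scale span_base)
    have ux: "\<And>i. i < r \<Longrightarrow> u x i \<in> span B" "(\<Sum>i<r. u x i) = 0" using assms(4) x unfolding zero_sum_def by auto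
    have pos: "0 < \<eta> / (norm z + 1)" using assms(6) by (intro divide_pos_pos) (auto intro: add_nonneg_pos)
    obtain \<delta> v where v: "0 < \<delta>" "\<delta> < \<eta> / (norm z + 1)" "(\<Sum>i<r. v i) = 0" "\<And>i. i < r \<Longrightarrow> v i \<in> span B"
      "\<And>i. i < r \<Longrightarrow> norm (v i - u x i) \<le> norm (0::'v) + \<delta> * norm z"
      "general_position (card B) X (?W(x := ?W x \<union> v ` {..<r}))"
      by (rule add_class[OF gp assms(1) x W ux assms(5) _ span_zero z _ pos, of 0])
         (use k assms(5) in \<open>auto simp: z_def\<close>)
    have small: "norm (v i - u x i) < \<eta>" if "i < r" for i
    proof -
      have "norm (v i - u x i) \<le> \<delta> * norm z" using v(5)[OF that] by simp
      also have "\<dots> \<le> \<delta> * (norm z + 1)" using v(1) by (intro mult_left_mono) auto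
      also have "\<dots> < \<eta>" using v(2) by (simp add: pos_less_divide_eq add_nonneg_pos)
      finally show ?thesis .
    qed
    let ?u = "u'(x := v)"
    have "(?W(x := ?W x \<union> v ` {..<r})) = (\<lambda>y. if y \<in> insert x Y then W y \<union> ?u y ` {..<r} else W y)"
      using insert.hyps by (intro ext) auto
    then have "general_position (card B) X (\<lambda>y. if y \<in> insert x Y then W y \<union> ?u y ` {..<r} else W y)"
      using v(6) by simp
    moreover have "zero_sum ?u r (insert x Y) (span B)" using u'(1) v unfolding zero_sum_def by auto
    moreover have "\<forall>y\<in>insert x Y. \<forall>i<r. norm (?u y i - u y i) < \<eta>" using u'(2) small by auto
    ultimately show ?case by blast
  qed
qed

text \<open>All classes but some \<open>x0\<close> of positive weight are perturbed first. This
  disturbs the relation by \<open>d\<close>, which the shift \<open>e\<close> of the chosen vector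
  of \<open>x0\<close> compensates. The further shift along \<open>z\<close>, made for general
  position, is a nonpositive combination of the other chosen vectors, so raising their coefficients
  cancels it.\<close>

lemma perturb_capturing:
  fixes u :: "'c \<Rightarrow> nat \<Rightarrow> 'v"
  assumes X: "finite X" "card B + 1 \<le> card X" and gp: "general_position (card B) X W" and W: "\<And>y. y \<in> X \<Longrightarrow> finite (W y)"
    and zs: "zero_sum u r X (span B)" and r: "2 \<le> r" and \<eta>: "0 < \<eta>"
    and P: "captures u X P" "\<forall>x. P x < r"
  shows "\<exists>u'. zero_sum u' r X (span B) \<and> (\<forall>y\<in>X. \<forall>i<r. norm (u' y i - u y i) < \<eta>) \<and>
     general_position (card B) X (\<lambda>y. W y \<union> u' y ` {..<r}) \<and> captures u' X P"
proof -
  obtain a where a: "\<And>x. x \<in> X \<Longrightarrow> 0 \<le> a x" "sum a X = 1" "(\<Sum>x\<in>X. a x *\<^sub>R u x (P x)) = 0"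
    using captures_normalized P(1) X(1) by blast
  obtain x0 where x0: "x0 \<in> X" "a x0 \<noteq> 0" using a(2) by (metis sum.neutral zero_neq_one)
  then have a0: "0 < a x0" using a(1) by force
  let ?Y = "X - {x0}"
  \<comment> \<open>The weights other than \<open>a x0\<close> sum to at most 1, so \<open>d\<close>
    has norm at most \<open>\<epsilon>\<close> and \<open>e\<close> at most
    \<open>\<eta> / 2\<close>; the other half is left for the shift along \<open>z\<close>.\<close>
  define \<epsilon> where "\<epsilon> = min \<eta> (\<eta> * a x0 / 2)"
  have \<epsilon>: "0 < \<epsilon>" using \<eta> a0 by (simp add: \<epsilon>_def)
  obtain u' where u': "zero_sum u' r ?Y (span B)" "\<forall>y\<in>?Y. \<forall>i<r. norm (u' y i - u y i) < \<epsilon>"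
    and gp': "general_position (card B) X (\<lambda>y. if y \<in> ?Y then W y \<union> u' y ` {..<r} else W y)"
    using add_classes[OF X(1) gp W zs r \<epsilon>, of ?Y] by auto
  let ?W = "\<lambda>y. if y \<in> ?Y then W y \<union> u' y ` {..<r} else W y"
  have W': "finite (?W y)" if "y \<in> X" for y using W that by auto
  let ?S = "small_spans ?Y ?W" and ?f = "\<lambda>x. u' x (P x)"
  \<comment> \<open>\<open>card B\<close> independent chosen vectors cannot all lie in one small
    span; here \<open>card B + 1\<close> classes are used, since \<open>x0\<close> is set
    aside.\<close>
  obtain K where K: "K \<subseteq> ?Y" "card K = card B" "finite K"
  proof -
    have "card B \<le> card ?Y" using X x0 by simp
    then show ?thesis using obtain_subset_with_card_n that by metis
  qed
  have indK: "independent_family K ?f"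
    using K P(2) by (intro general_positionD[OF gp']) auto
  have "\<exists>k. (\<forall>x\<in>?Y. 0 \<le> k x) \<and> (\<forall>H\<in>?S. (\<Sum>x\<in>?Y. k x *\<^sub>R ?f x) \<notin> H)"
  proof (rule cone_avoids_subspaces)
    show "finite ?S" using X(1) by (intro finite_small_spans W') auto
    show "\<exists>x\<in>?Y. ?f x \<notin> H" if "H \<in> ?S" for H
      using not_in_small_span[OF _ that K(3) indK K(2)] K(1) X(1) by auto
  qed (use X(1) small_spans_subspace in auto)
  then obtain k where k: "\<And>x. x \<in> ?Y \<Longrightarrow> 0 \<le> k x" "\<And>H. H \<in> ?S \<Longrightarrow> (\<Sum>x\<in>?Y. k x *\<^sub>R ?f x) \<notin> H" by blast
  define z where "z = - (\<Sum>x\<in>?Y. k x *\<^sub>R ?f x)"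
  have fB: "?f x \<in> span B" "u x (P x) \<in> span B" if "x \<in> ?Y" for x
    using u'(1) zs P(2) that unfolding zero_sum_def by auto
  have z: "z \<in> span B" unfolding z_def by (intro span_neg span_sum span_scale fB)
  have zS: "z \<notin> H" if "H \<in> ?S" for H
    using k(2)[OF that] subspace_neg[OF small_spans_subspace[OF that], of z] unfolding z_def by auto
  define d where "d = (\<Sum>x\<in>?Y. a x *\<^sub>R (?f x - u x (P x)))"
  define e where "e = - ((1 / a x0) *\<^sub>R d)"
  have e: "e \<in> span B"
    unfolding e_def d_def by (intro span_neg span_scale span_sum span_diff fB)
  have "norm d \<le> (\<Sum>x\<in>?Y. a x * \<epsilon>)"
    unfolding d_def
  proof (intro order_trans[OF norm_sum] sum_mono)
    fix x assume x: "x \<in> ?Y"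
    then have "norm (?f x - u x (P x)) \<le> \<epsilon>" using u'(2) P(2) by (simp add: less_imp_le)
    moreover have "0 \<le> a x" using a(1) x by simp
    ultimately show "norm (a x *\<^sub>R (?f x - u x (P x))) \<le> a x * \<epsilon>"
      by (simp add: mult_left_mono)
  qed
  also have "\<dots> = sum a ?Y * \<epsilon>" by (simp only: sum_distrib_right)
  also have "\<dots> \<le> 1 * \<epsilon>"
  proof (rule mult_right_mono)
    have "sum a X = a x0 + sum a ?Y" using X(1) x0 by (simp add: sum.remove)
    then show "sum a ?Y \<le> 1" using a(2) a0 by simp
  qed (use \<epsilon> in simp)
  finally have "norm d \<le> \<eta> * a x0 / 2" by (simp add: \<epsilon>_def)
  then have enorm: "norm e \<le> \<eta> / 2" unfolding e_def using a0 by (simp add: field_simps)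
  have ux: "\<And>i. i < r \<Longrightarrow> u x0 i \<in> span B" "(\<Sum>i<r. u x0 i) = 0" using zs x0 unfolding zero_sum_def by auto
  have pos: "0 < \<eta> / 2 / (norm z + 1)" using \<eta> by (intro divide_pos_pos) (auto intro: add_nonneg_pos)
  obtain \<delta> v where v: "0 < \<delta>" "\<delta> < \<eta> / 2 / (norm z + 1)" "v (P x0) = u x0 (P x0) + (e + \<delta> *\<^sub>R z)"
    "(\<Sum>i<r. v i) = 0" "\<And>i. i < r \<Longrightarrow> v i \<in> span B"
    "\<And>i. i < r \<Longrightarrow> norm (v i - u x0 i) \<le> norm e + \<delta> * norm z"
    "general_position (card B) X (?W(x0 := ?W x0 \<union> v ` {..<r}))"
    by (rule add_class[OF gp' X(1) x0(1) W' ux r _ e z zS pos, of "P x0"])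
       (use P(2) in auto)
  have small: "norm (v i - u x0 i) < \<eta>" if "i < r" for i
  proof -
    have "\<delta> * norm z \<le> \<delta> * (norm z + 1)" using v(1) by (intro mult_left_mono) auto
    also have "\<dots> < \<eta> / 2"
    proof -
      have "0 < norm z + 1" by (simp add: add_nonneg_pos)
      then show ?thesis using v(2) by (simp only: pos_less_divide_eq)
    qed
    finally show ?thesis using v(6)[OF that] enorm by simp
  qed
  let ?u = "u'(x0 := v)"
  have "?W(x0 := ?W x0 \<union> v ` {..<r}) = (\<lambda>y. if y \<in> X then W y \<union> ?u y ` {..<r} else W y)"
    using x0 by (intro ext) auto
  then have "general_position (card B) X (\<lambda>y. W y \<union> ?u y ` {..<r})"
    using v(7) unfolding general_position_def by (auto simp: subset_iff)
  moreover have "zero_sum ?u r X (span B)" using u'(1) v unfolding zero_sum_def by auto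
  moreover have "norm (?u y i - u y i) < \<eta>" if "y \<in> X" "i < r" for y i
    using u'(2) small that by (force simp: \<epsilon>_def)
  moreover have "captures ?u X P"
  proof -
    \<comment> \<open>The old weights, plus what cancels the contribution
      \<open>(a x0 * \<delta>) *\<^sub>R z\<close> of class \<open>x0\<close>.\<close>
    define c where "c x = (if x = x0 then a x0 else a x + a x0 * \<delta> * k x)" for x
    have "(\<Sum>x\<in>?Y. c x *\<^sub>R ?u x (P x)) = (\<Sum>x\<in>?Y. a x *\<^sub>R ?f x + (a x0 * \<delta>) *\<^sub>R (k x *\<^sub>R ?f x))"
      by (intro sum.cong) (auto simp: c_def scaleR_add_left)
    also have "\<dots> = (\<Sum>x\<in>?Y. a x *\<^sub>R ?f x) - (a x0 * \<delta>) *\<^sub>R z"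
      by (simp add: sum.distrib scaleR_sum_right z_def)
    finally have 1: "(\<Sum>x\<in>?Y. c x *\<^sub>R ?u x (P x)) = (\<Sum>x\<in>?Y. a x *\<^sub>R ?f x) - (a x0 * \<delta>) *\<^sub>R z" .
    have 2: "a x0 *\<^sub>R u x0 (P x0) = - (\<Sum>x\<in>?Y. a x *\<^sub>R u x (P x))"
      using a(3) X(1) x0 by (simp add: sum.remove eq_neg_iff_add_eq_0)
    have 3: "d = (\<Sum>x\<in>?Y. a x *\<^sub>R ?f x) - (\<Sum>x\<in>?Y. a x *\<^sub>R u x (P x))"
      unfolding d_def by (simp add: scaleR_diff_right sum_subtractf)
    have "c x0 *\<^sub>R ?u x0 (P x0) = a x0 *\<^sub>R u x0 (P x0) - d + (a x0 * \<delta>) *\<^sub>R z"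
      using a0 v(3) by (simp add: c_def e_def scaleR_add_right scaleR_diff_right)
    then have "c x0 *\<^sub>R ?u x0 (P x0) + (\<Sum>x\<in>?Y. c x *\<^sub>R ?u x (P x)) = 0"
      unfolding 1 2 3 by simp
    then have "(\<Sum>x\<in>X. c x *\<^sub>R ?u x (P x)) = 0"
      using X(1) x0 by (simp only: sum.remove)
    moreover have "0 \<le> c x" if "x \<in> X" for x
      using a(1) a0 k(1) v(1) that by (auto simp: c_def)
    moreover have "c x0 \<noteq> 0" using a0 by (simp add: c_def)
    ultimately show ?thesis unfolding captures_def using x0 by blast
  qed
  ultimately show ?thesis by blast
qed

text \<open>The colourful Caratheodory theorem for arbitrary classes: it holds for a generic
  perturbation, and closedness of capturing carries it back.\<close>

lemma captures_exists_degenerate: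
  fixes u :: "'c \<Rightarrow> nat \<Rightarrow> 'v"
  assumes "finite X" "card B + 1 \<le> card X" "zero_sum u r X (span B)" "2 \<le> r" "\<forall>x. \<sigma> x < r"
  shows "\<exists>\<rho>. (\<forall>x. \<rho> x < r) \<and> (\<forall>x. x \<notin> X \<longrightarrow> \<rho> x = \<sigma> x) \<and> captures u X \<rho>"
proof -
  obtain \<eta> where \<eta>: "\<eta> > 0" "\<And>u' J \<sigma>. (\<And>x i. x \<in> X \<Longrightarrow> i < r \<Longrightarrow> norm (u' x i - u x i) < \<eta>) \<Longrightarrow>
      J \<subseteq> X \<Longrightarrow> \<forall>x. \<sigma> x < r \<Longrightarrow> captures u' J \<sigma> \<Longrightarrow> captures u J \<sigma>"
    using captures_closed[OF assms(1), of r u] by metis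
  have "general_position (card B) X (\<lambda>_. {} :: 'v set)"
    unfolding general_position_def independent_family_def by blast
  then obtain u' where u': "zero_sum u' r X (span B)" "\<forall>y\<in>X. \<forall>i<r. norm (u' y i - u y i) < \<eta>"
     "general_position (card B) X (\<lambda>y. if y \<in> X then {} \<union> u' y ` {..<r} else {})"
    using add_classes[OF assms(1) _ _ assms(3,4) \<eta>(1) order_refl, of "\<lambda>_. {}"] by auto
  obtain I where I: "I \<subseteq> X" "card I = card B + 1" "finite I"
    using assms(2) obtain_subset_with_card_n by metis
  have "generic_classes u' r I (span B)"
    using general_position_generic[OF I(3,2,1) u'(3,1)] by auto
  moreover have "I \<noteq> {}" using I(2) by auto
  ultimately obtain \<rho> where \<rho>: "\<forall>x. \<rho> x < r" "\<forall>x. x \<notin> I \<longrightarrow> \<rho> x = \<sigma> x" "captures u' I \<rho>"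
    using generic_classes.captures_exists[of u' r I "span B" \<sigma>] assms(5) by blast
  then have "captures u X \<rho>"
    using \<eta>(2)[of u' X \<rho>] u'(2) captures_mono[OF \<rho>(3) I(1) assms(1)] by blast
  then show ?thesis using \<rho> I(1) by blast
qed

lemma moves_mono:
  assumes "\<And>J \<sigma>. J \<subseteq> X \<Longrightarrow> \<forall>x. \<sigma> x < r \<Longrightarrow> captures u' J \<sigma> \<Longrightarrow> captures u J \<sigma>"
  shows "(moves u' r X)\<^sup>* \<subseteq> (moves u r X)\<^sup>*"
proof (rule rtrancl_mono)
  show "moves u' r X \<subseteq> moves u r X" unfolding moves_def using assms[of "X - {_}"] by blast
qed

text \<open>Both transversals survive in suitable generic perturbations of the classes. Passing from one
  perturbation to the other one colour at a time, there is always a capturing transversal that does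
  not involve the changing colour.\<close>

lemma degenerate_moves_connected:
  fixes u :: "'c \<Rightarrow> nat \<Rightarrow> 'v"
  assumes X: "finite X" "card X = card B + 2" and zs: "zero_sum u r X (span B)" and r: "2 \<le> r"
    and P: "captures u X P" "\<forall>x. P x < r" and Q: "captures u X Q" "\<forall>x. Q x < r"
    and PQ: "\<And>x. x \<notin> X \<Longrightarrow> P x = Q x"
  shows "(P, Q) \<in> (moves u r X)\<^sup>*"
proof -
  obtain \<eta> where \<eta>: "\<eta> > 0" "\<And>u' J \<sigma>. (\<And>x i. x \<in> X \<Longrightarrow> i < r \<Longrightarrow> norm (u' x i - u x i) < \<eta>) \<Longrightarrow>
      J \<subseteq> X \<Longrightarrow> \<forall>x. \<sigma> x < r \<Longrightarrow> captures u' J \<sigma> \<Longrightarrow> captures u J \<sigma>"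
    using captures_closed[OF X(1), of r u] by metis
  have gp0: "general_position (card B) X (\<lambda>_. {} :: 'v set)"
    unfolding general_position_def independent_family_def by blast
  have cX: "card B + 1 \<le> card X" using X by simp
  obtain u1 where u1: "zero_sum u1 r X (span B)" "\<forall>y\<in>X. \<forall>i<r. norm (u1 y i - u y i) < \<eta>"
    "general_position (card B) X (\<lambda>y. {} \<union> u1 y ` {..<r})" "captures u1 X P"
    using perturb_capturing[OF X(1) cX gp0 _ zs r \<eta>(1) P] by blast
  \<comment> \<open>The pools of \<open>u1\<close> are retained here, so every mixture of classes of
    \<open>u1\<close> and \<open>u2\<close> is generic.\<close>
  obtain u2 where u2: "zero_sum u2 r X (span B)" "\<forall>y\<in>X. \<forall>i<r. norm (u2 y i - u y i) < \<eta>"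
    "general_position (card B) X (\<lambda>y. ({} \<union> u1 y ` {..<r}) \<union> u2 y ` {..<r})" "captures u2 X Q"
    using perturb_capturing[OF X(1) cX u1(3) _ zs r \<eta>(1) Q] by blast
  define h where "h Y x = (if x \<in> Y then u2 x else u1 x)" for Y x
  have near: "norm (h Y x i - u x i) < \<eta>" if "x \<in> X" "i < r" for Y x i
    using u1(2) u2(2) that by (simp add: h_def)
  have zsh: "zero_sum (h Y) r X (span B)" for Y
    using u1(1) u2(1) unfolding zero_sum_def h_def by simp
  have gen: "generic_classes (h Y) r (X - {x}) (span B)" if "x \<in> X" for Y x
    by (rule general_position_generic[OF _ _ _ u2(3) zsh]) (use X that in \<open>auto simp: h_def\<close>)
  have lift: "(moves (h Y) r X)\<^sup>* \<subseteq> (moves u r X)\<^sup>*" for Y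
    using \<eta>(2)[of "h Y"] near by (intro moves_mono) blast
  have ne: "X - {x} \<noteq> {}" for x
  proof
    assume "X - {x} = {}"
    then have "card X \<le> card {x}" by (intro card_mono) auto
    then show False using X by simp
  qed
  have conn: "(\<sigma>, \<sigma>') \<in> (moves u r X)\<^sup>*"
    if "\<forall>x. \<sigma> x < r" "\<forall>x. \<sigma>' x < r" "\<And>x. x \<notin> X \<Longrightarrow> \<sigma> x = \<sigma>' x" "captures (h Y) X \<sigma>" "captures (h Y) X \<sigma>'" for Y \<sigma> \<sigma>'
  proof -
    obtain x where x: "x \<in> X" using ne by blast
    have "(\<sigma>, \<sigma>') \<in> (moves (h Y) r X)\<^sup>*"
      using zsh[of Y] x ne that
      by (intro generic_moves_connected[OF X(1) x gen[OF x]]) (auto simp: zero_sum_def)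
    then show ?thesis using lift by blast
  qed
  have "(P, \<sigma>) \<in> (moves u r X)\<^sup>*"
    if "finite Y" "Y \<subseteq> X" "\<forall>x. \<sigma> x < r" "\<forall>x. x \<notin> X \<longrightarrow> \<sigma> x = P x" "captures (h Y) X \<sigma>" for Y \<sigma>
    using that
  proof (induction Y arbitrary: \<sigma> rule: finite_induct)
    case empty
    have "h {} = u1" by (simp add: h_def fun_eq_iff)
    then show ?case using empty u1(4) P by (intro conn[of P \<sigma> "{}"]) auto
  next
    case (insert x Y)
    obtain \<rho> where \<rho>: "\<forall>z. \<rho> z < r" "\<forall>z. z \<notin> X - {x} \<longrightarrow> \<rho> z = P z" "captures (h Y) (X - {x}) \<rho>"
    proof -
      have x: "x \<in> X" using insert.prems by blast
      show ?thesis using generic_classes.captures_exists[OF gen[OF x, of Y] P(2) ne] that by metis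
    qed
    have "captures (h (insert x Y)) (X - {x}) \<rho> = captures (h Y) (X - {x}) \<rho>"
    proof -
      have "(\<Sum>z\<in>X - {x}. a z *\<^sub>R h (insert x Y) z (\<rho> z)) = (\<Sum>z\<in>X - {x}. a z *\<^sub>R h Y z (\<rho> z))" for a
        by (intro sum.cong) (auto simp: h_def)
      then show ?thesis unfolding captures_def by simp
    qed
    then have c: "captures (h (insert x Y)) X \<rho>" "captures (h Y) X \<rho>"
      using \<rho>(3) captures_mono[of _ "X - {x}" \<rho> X] X(1) by auto
    have "(P, \<rho>) \<in> (moves u r X)\<^sup>*" using insert \<rho> c by auto
    moreover have "(\<rho>, \<sigma>) \<in> (moves u r X)\<^sup>*"
      using insert.prems \<rho> c by (intro conn[of \<rho> \<sigma> "insert x Y"]) auto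
    ultimately show ?case by (rule rtrancl_trans)
  qed
  from this[of X Q] show ?thesis
  proof -
    have "(\<Sum>z\<in>X. a z *\<^sub>R h X z (Q z)) = (\<Sum>z\<in>X. a z *\<^sub>R u2 z (Q z))" for a
      by (intro sum.cong) (auto simp: h_def)
    then have "captures (h X) X Q" using u2(4) unfolding captures_def by simp
    then show ?thesis using \<open>\<lbrakk>finite X; X \<subseteq> X; \<forall>x. Q x < r; \<forall>x. x \<notin> X \<longrightarrow> Q x = P x; captures (h X) X Q\<rbrakk> \<Longrightarrow> (P, Q) \<in> (moves u r X)\<^sup>*\<close>
      X(1) Q(2) PQ by auto
  qed
qed

section \<open>Surplus classes\<close>

lemma captures_without:
  fixes u :: "'c \<Rightarrow> nat \<Rightarrow> 'v"
  assumes X: "finite X" "card B + 2 \<le> card X" and B: "\<And>x. x \<in> X \<Longrightarrow> u x (\<sigma> x) \<in> span B" and c: "captures u X \<sigma>"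
  shows "\<exists>y\<in>X. captures u (X - {y}) \<sigma>"
proof -
  let ?f = "\<lambda>x. u x (\<sigma> x)"
  obtain a where a: "\<forall>x\<in>X. 0 \<le> a x" "\<exists>x\<in>X. a x \<noteq> 0" "(\<Sum>x\<in>X. a x *\<^sub>R ?f x) = 0"
    using c unfolding captures_def by blast
  obtain x0 where x0: "x0 \<in> X" "a x0 \<noteq> 0" using a by blast
  \<comment> \<open>The relation to be subtracted must leave out \<open>x0\<close>, so that the
    coefficient of \<open>x0\<close> survives and the result stays nontrivial. This is why
    \<open>card B + 2\<close> classes are required.\<close>
  have "\<not> independent_family (X - {x0}) ?f"
  proof
    assume "independent_family (X - {x0}) ?f"
    then have "card (X - {x0}) \<le> card B"
      using X B finite_B by (intro independent_family_card[of _ ?f]) auto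
    then show False using X x0 by simp
  qed
  then obtain b0 where b0: "(\<Sum>x\<in>X - {x0}. b0 x *\<^sub>R ?f x) = 0" "\<exists>x\<in>X - {x0}. b0 x \<noteq> 0"
    unfolding independent_family_def by blast
  then obtain y0 where y0: "y0 \<in> X - {x0}" "b0 y0 \<noteq> 0" by blast
  \<comment> \<open>Scaled to \<open>b y0 = 1\<close>, so that some coefficient is positive and the
    ratio test has a candidate.\<close>
  define b where "b x = (if x = x0 then 0 else b0 x / b0 y0)" for x
  have "(\<Sum>x\<in>X. b x *\<^sub>R ?f x) = (\<Sum>x\<in>X - {x0}. (1 / b0 y0) *\<^sub>R (b0 x *\<^sub>R ?f x))"
    using X(1) x0(1) by (subst sum.remove[of X x0]) (auto simp: b_def intro!: sum.cong)
  also have "\<dots> = 0" using b0(1) by (simp only: scaleR_sum_right[symmetric] scaleR_zero_right)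
  finally have b: "(\<Sum>x\<in>X. b x *\<^sub>R ?f x) = 0" .
  define S where "S = {x \<in> X. 0 < b x}"
  have S: "finite S" "y0 \<in> S" using X y0 by (auto simp: S_def b_def)
  define g where "g x = a x / b x" for x
  define y where "y = arg_min_on g S"
  have y: "y \<in> S" and ymin: "\<And>x. x \<in> S \<Longrightarrow> g y \<le> g x"
    using arg_min_if_finite[of S g] S arg_min_least[of S _ g] unfolding y_def by auto
  have by0: "0 < b y" "y \<in> X" "y \<noteq> x0" using y by (auto simp: S_def b_def split: if_splits)
  have gy: "0 \<le> g y" using a(1) by0 by (simp add: g_def)
  define d where "d x = a x - g y * b x" for x
  have "(\<Sum>x\<in>X. d x *\<^sub>R ?f x) = (\<Sum>x\<in>X. a x *\<^sub>R ?f x) - g y *\<^sub>R (\<Sum>x\<in>X. b x *\<^sub>R ?f x)"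
    by (simp add: d_def scaleR_diff_left sum_subtractf scaleR_sum_right)
  then have "(\<Sum>x\<in>X. d x *\<^sub>R ?f x) = 0" using a(3) b by simp
  moreover have "d y = 0" using by0 by (simp add: d_def g_def)
  ultimately have "(\<Sum>x\<in>X - {y}. d x *\<^sub>R ?f x) = 0" using X(1) by0(2) by (simp add: sum.remove)
  moreover have "0 \<le> d x" if x: "x \<in> X" for x
  proof (cases "0 < b x")
    case True
    then have "g y \<le> a x / b x" using ymin[of x] x by (simp add: S_def g_def)
    then show ?thesis using True by (simp add: d_def field_simps)
  next
    case False
    then have "g y * b x \<le> 0" using gy by (simp add: mult_nonneg_nonpos)
    moreover have "0 \<le> a x" using a(1) x by blast
    ultimately show ?thesis by (simp add: d_def)
  qed
  moreover have "d x0 \<noteq> 0" using x0 by (simp add: d_def b_def)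
  ultimately have "captures u (X - {y}) \<sigma>" unfolding captures_def using x0 by0 by blast
  then show ?thesis using by0 by blast
qed

text \<open>Beyond \<open>card B + 2\<close> classes, \<open>P\<close> can do without some
  \<open>x\<close> and \<open>Q\<close> without some \<open>y\<close>. At least
  \<open>card B + 1\<close> classes remain off both, so some transversal captures the origin there.
  It is linked to \<open>P\<close> inside \<open>X - {x}\<close> and, after free changes at
  \<open>x\<close> and \<open>y\<close>, to \<open>Q\<close> inside \<open>X - {y}\<close>.\<close>

theorem moves_connected:
  fixes u :: "'c \<Rightarrow> nat \<Rightarrow> 'v"
  assumes "finite X" "card B + 2 \<le> card X" "zero_sum u r X (span B)" "2 \<le> r"
    and "captures u X P" "\<forall>x. P x < r" "captures u X Q" "\<forall>x. Q x < r" "\<And>x. x \<notin> X \<Longrightarrow> P x = Q x"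
  shows "(P, Q) \<in> (moves u r X)\<^sup>*"
  using assms
proof (induction "card X" arbitrary: X P Q rule: less_induct)
  case less
  show ?case
  proof (cases "card X = card B + 2")
    case True
    then show ?thesis using less.prems by (intro degenerate_moves_connected) auto
  next
    case False
    note X = less.prems(1) and zs = less.prems(3)
    have inB: "u x (\<sigma> x) \<in> span B" if "x \<in> X" "\<forall>x. \<sigma> x < r" for x \<sigma>
      using zs that unfolding zero_sum_def by blast
    obtain x where x: "x \<in> X" "captures u (X - {x}) P"
      using captures_without[OF X less.prems(2) _ less.prems(5)] inB less.prems(6) by blast
    obtain y where y: "y \<in> X" "captures u (X - {y}) Q"
      using captures_without[OF X less.prems(2) _ less.prems(7)] inB less.prems(8) by blast
    have zs': "zero_sum u r Z (span B)" if "Z \<subseteq> X" for Z using zs that unfolding zero_sum_def by blast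
    have lift: "(moves u r (X - {w}))\<^sup>* \<subseteq> (moves u r X)\<^sup>*" if "w \<in> X" for w
    proof (rule rtrancl_mono, rule subrelI)
      fix \<sigma> \<sigma>' assume "(\<sigma>, \<sigma>') \<in> moves u r (X - {w})"
      then obtain z i where *: "z \<in> X - {w}" "i < r" "\<forall>x. \<sigma> x < r" "captures u (X - {w} - {z}) \<sigma>" "\<sigma>' = \<sigma>(z := i)"
        unfolding moves_def by blast
      then have "captures u (X - {z}) \<sigma>" using captures_mono[OF *(4), of "X - {z}"] X by blast
      then show "(\<sigma>, \<sigma>') \<in> moves u r X" using * by (simp add: movesI)
    qed
    have IH: "(\<sigma>, \<sigma>') \<in> (moves u r X)\<^sup>*"
      if "w \<in> X" "captures u (X - {w}) \<sigma>" "\<forall>x. \<sigma> x < r" "captures u (X - {w}) \<sigma>'" "\<forall>x. \<sigma>' x < r"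
        "\<And>x. x \<notin> X - {w} \<Longrightarrow> \<sigma> x = \<sigma>' x" for w \<sigma> \<sigma>'
    proof -
      have "card (X - {w}) < card X" "card B + 2 \<le> card (X - {w})"
        using that(1) X False less.prems(2) by (auto simp: card_Diff1_less)
      then have "(\<sigma>, \<sigma>') \<in> (moves u r (X - {w}))\<^sup>*"
        using less.hyps[of "X - {w}" \<sigma> \<sigma>'] that X zs' less.prems(4) by blast
      then show ?thesis using lift[OF that(1)] by blast
    qed
    let ?Z = "X - {x, y}"
    have "card X - card {x, y} \<le> card ?Z" by (rule diff_card_le_card_Diff) simp
    moreover have "card {x, y} \<le> 2" by (simp add: card_insert_if)
    ultimately have "card B + 1 \<le> card ?Z" using less.prems(2) False by linarith
    then obtain \<rho> where \<rho>: "\<forall>z. \<rho> z < r" "\<forall>z. z \<notin> ?Z \<longrightarrow> \<rho> z = P z" "captures u ?Z \<rho>"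
      using captures_exists_degenerate[OF _ _ zs' less.prems(4,6), of ?Z] X by auto
    let ?\<rho>1 = "\<rho>(x := Q x)" and ?\<rho>2 = "\<rho>(x := Q x, y := Q y)"
    have c1: "captures u ?Z ?\<rho>1" using \<rho>(3) captures_cong[of ?Z \<rho> ?\<rho>1 u] by auto
    have c2: "captures u ?Z ?\<rho>2" using \<rho>(3) captures_cong[of ?Z \<rho> ?\<rho>2 u] by auto
    have sub: "?Z \<subseteq> X - {x}" "?Z \<subseteq> X - {y}" "finite (X - {x})" "finite (X - {y})" using X by auto
    have up: "captures u (X - {x}) \<sigma>" "captures u (X - {y}) \<sigma>" if "captures u ?Z \<sigma>" for \<sigma>
      using captures_mono[OF that sub(1,3)] captures_mono[OF that sub(2,4)] .
    have r1: "\<forall>z. ?\<rho>1 z < r" "\<forall>z. ?\<rho>2 z < r" using \<rho>(1) less.prems(8) by auto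
    have "(P, \<rho>) \<in> (moves u r X)\<^sup>*"
    proof (rule IH[OF x less.prems(6) up(1)[OF \<rho>(3)] \<rho>(1)])
      show "P z = \<rho> z" if "z \<notin> X - {x}" for z using that \<rho>(2) by auto
    qed
    moreover have "(\<rho>, ?\<rho>1) \<in> moves u r X"
      using movesI[OF x(1) _ \<rho>(1) up(1)[OF \<rho>(3)], of "Q x"] less.prems(8) by simp
    moreover have "(?\<rho>1, ?\<rho>2) \<in> moves u r X"
      using movesI[OF y(1) _ r1(1) up(2)[OF c1], of "Q y"] less.prems(8) by simp
    moreover have "(?\<rho>2, Q) \<in> (moves u r X)\<^sup>*"
    proof (rule IH[OF y(1) up(2)[OF c2] r1(2) y(2) less.prems(8)])
      show "?\<rho>2 z = Q z" if "z \<notin> X - {y}" for z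
        using that \<rho>(2) less.prems(9)[of z] by (cases "z = y") auto
    qed
    ultimately show ?thesis by (meson rtrancl_trans rtrancl.rtrancl_into_rtrancl)
  qed
qed

end

section \<open>Tverberg partitions\<close>

text \<open>On the discrete space \<open>nat\<close> every bounded sequence is continuous, so this
  type supplies the norm that perturbation requires.\<close>

definition padded :: "nat \<Rightarrow> (nat \<Rightarrow> 'b::real_normed_vector) \<Rightarrow> nat \<Rightarrow>\<^sub>C 'b" where
  "padded n g = Bcontfun (\<lambda>j. if j < n then g j else 0)"

lemma apply_padded: "apply_bcontfun (padded n g) j = (if j < n then g j else 0)"
proof -
  have "finite (range (\<lambda>j. if j < n then g j else 0))"
    by (rule finite_subset[of _ "insert 0 (g ` {..<n})"]) auto
  then have "(\<lambda>j. if j < n then g j else 0) \<in> bcontfun"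
    by (simp add: bcontfun_def finite_imp_bounded)
  then show ?thesis by (simp add: padded_def Bcontfun_inverse)
qed

lemma apply_bcontfun_sum: "apply_bcontfun (sum f A) j = (\<Sum>a\<in>A. apply_bcontfun (f a) j)"
  by (induction A rule: infinite_finite_induct) auto

lemma bcontfun_eq_0_iff: "f = 0 \<longleftrightarrow> (\<forall>j. apply_bcontfun f j = 0)"
  by (auto intro: bcontfun_eqI)

text \<open>Sarkaria's tensor: the vectors \<open>padded n (\<lambda>j. of_bool (i = j) - of_bool (i = n))\<close>, \<open>i \<le> n\<close>,
  span \<open>\<real>\<^sup>n\<close> and sum to zero. They are tensored with the lifted point \<open>(x, 1)\<close>. Since \<open>n = r - 1\<close> is not
  a type, \<open>\<real>\<^sup>n\<close> sits inside a space of sequences.\<close>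

definition sarkaria :: "nat \<Rightarrow> 'a::euclidean_space \<Rightarrow> nat \<Rightarrow> nat \<Rightarrow>\<^sub>C ('a \<times> real)" where
  "sarkaria r x i = padded (r - 1) (\<lambda>j. (of_bool (i = j) - of_bool (i = r - 1)) *\<^sub>R (x, 1))"

text \<open>The coordinate tensors. A basis is extracted from them later, and the bound on their
  number is the origin of \<open>N\<close>.\<close>

definition unit_sequences :: "nat \<Rightarrow> (nat \<Rightarrow>\<^sub>C 'b::euclidean_space) set" where
  "unit_sequences n = (\<lambda>(k, b). padded n (\<lambda>j. if j = k then b else 0)) ` ({..<n} \<times> Basis)"

lemma unit_sequences_card:
  "finite (unit_sequences n :: (nat \<Rightarrow>\<^sub>C 'b::euclidean_space) set)"
  "card (unit_sequences n :: (nat \<Rightarrow>\<^sub>C 'b::euclidean_space) set) \<le> n * DIM('b)"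
proof -
  show "finite (unit_sequences n :: (nat \<Rightarrow>\<^sub>C 'b::euclidean_space) set)" unfolding unit_sequences_def by simp
  show "card (unit_sequences n :: (nat \<Rightarrow>\<^sub>C 'b::euclidean_space) set) \<le> n * DIM('b)"
    unfolding unit_sequences_def by (rule order_trans[OF card_image_le]) auto
qed

lemma padded_in_span: "padded n g \<in> span (unit_sequences n)"
proof -
  have "padded n g = (\<Sum>k<n. \<Sum>b\<in>Basis. (g k \<bullet> b) *\<^sub>R padded n (\<lambda>j. if j = k then b else 0))"
  proof (rule bcontfun_eqI)
    fix j
    show "apply_bcontfun (padded n g) j =
      apply_bcontfun (\<Sum>k<n. \<Sum>b\<in>Basis. (g k \<bullet> b) *\<^sub>R padded n (\<lambda>j. if j = k then b else 0)) j"
    proof (cases "j < n")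
      case True
      have "apply_bcontfun (\<Sum>k<n. \<Sum>b\<in>Basis. (g k \<bullet> b) *\<^sub>R padded n (\<lambda>j. if j = k then b else 0)) j
        = (\<Sum>k<n. if j = k then (\<Sum>b\<in>Basis. (g k \<bullet> b) *\<^sub>R b) else 0)"
        using True unfolding apply_bcontfun_sum by (intro sum.cong) (auto simp: apply_padded)
      also have "\<dots> = g j" using True by (simp add: euclidean_representation)
      finally show ?thesis using True by (simp add: apply_padded)
    qed (simp add: apply_bcontfun_sum apply_padded)
  qed
  also have "\<dots> \<in> span (unit_sequences n)"
    by (intro span_sum span_scale span_base) (auto simp: unit_sequences_def)
  finally show ?thesis .
qed

lemma sarkaria_sum:
  assumes "1 \<le> r"
  shows "(\<Sum>i<r. sarkaria r x i) = 0"
proof (rule bcontfun_eqI)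
  fix j
  have "(\<Sum>i<r. (of_bool (i = j) - of_bool (i = r - 1)) *\<^sub>R (x, 1::real))
     = (\<Sum>i<r. of_bool (i = j) - of_bool (i = r - 1) :: real) *\<^sub>R (x, 1)"
    by (simp only: scaleR_sum_left)
  also have "(\<Sum>i<r. of_bool (i = j) - of_bool (i = r - 1) :: real) = 0" if "j < r - 1"
    using that assms by (simp add: sum_subtractf of_bool_def)
  finally show "apply_bcontfun (\<Sum>i<r. sarkaria r x i) j = apply_bcontfun 0 j"
    by (cases "j < r - 1") (simp_all add: apply_bcontfun_sum sarkaria_def apply_padded del: scaleR_Pair)
qed

text \<open>For \<open>j < r - 1\<close>, coordinate \<open>j\<close> of the combination is the
  weighted sum of the lifted points labelled \<open>j\<close> minus that of the points labelled
  \<open>r - 1\<close>.\<close>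

lemma sarkaria_combination:
  assumes "finite X" "\<forall>x. \<sigma> x < r"
  shows "(\<Sum>x\<in>X. a x *\<^sub>R sarkaria r x (\<sigma> x)) = 0 \<longleftrightarrow>
    (\<forall>j<r. (\<Sum>x | x \<in> X \<and> \<sigma> x = j. a x *\<^sub>R (x, 1)) = (\<Sum>x | x \<in> X \<and> \<sigma> x = r - 1. a x *\<^sub>R (x, 1::real)))"
proof -
  define S where "S j = (\<Sum>x | x \<in> X \<and> \<sigma> x = j. a x *\<^sub>R (x, 1::real))" for j
  have "(\<Sum>x\<in>X. a x *\<^sub>R ((of_bool (\<sigma> x = j) - of_bool (\<sigma> x = r - 1)) *\<^sub>R (x, 1))) = S j - S (r - 1)" for j
  proof -
    have "(\<Sum>x\<in>X. a x *\<^sub>R ((of_bool (\<sigma> x = j) - of_bool (\<sigma> x = r - 1)) *\<^sub>R (x, 1)))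
      = (\<Sum>x\<in>X. (if \<sigma> x = j then a x *\<^sub>R (x, 1) else 0) - (if \<sigma> x = r - 1 then a x *\<^sub>R (x, 1) else 0))"
      by (intro sum.cong) (auto simp: of_bool_def simp del: scaleR_Pair)
    also have "\<dots> = S j - S (r - 1)"
      unfolding S_def sum_subtractf using assms(1) by (simp only: sum.inter_filter)
    finally show ?thesis .
  qed
  then have "apply_bcontfun (\<Sum>x\<in>X. a x *\<^sub>R sarkaria r x (\<sigma> x)) j = (if j < r - 1 then S j - S (r - 1) else 0)" for j
    by (simp add: apply_bcontfun_sum sarkaria_def apply_padded del: scaleR_Pair)
  then have "(\<Sum>x\<in>X. a x *\<^sub>R sarkaria r x (\<sigma> x)) = 0 \<longleftrightarrow> (\<forall>j. (if j < r - 1 then S j - S (r - 1) else 0) = 0)"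
    by (simp add: bcontfun_eq_0_iff)
  also have "\<dots> \<longleftrightarrow> (\<forall>j<r. S j = S (r - 1))"
  proof (intro iffI allI impI)
    fix j assume *: "\<forall>j. (if j < r - 1 then S j - S (r - 1) else 0) = 0" "j < r"
    show "S j = S (r - 1)"
    proof (cases "j = r - 1")
      case False
      then have "j < r - 1" using *(2) by linarith
      then show ?thesis using spec[OF *(1), of j] by simp
    qed simp
  next
    fix j assume *: "\<forall>j<r. S j = S (r - 1)"
    show "(if j < r - 1 then S j - S (r - 1) else 0) = 0"
      using spec[OF *, of j] by (cases "j < r - 1") auto
  qed
  finally show ?thesis by (simp add: S_def)
qed

definition classes_of :: "'a set \<Rightarrow> ('a \<Rightarrow> nat) \<Rightarrow> nat \<Rightarrow> 'a set" where
  "classes_of X \<sigma> i = {x \<in> X. \<sigma> x = i}"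

text \<open>The component 1 of the lifted points gives all classes the same total weight
  \<open>s\<close>, the other component the same weighted sum; dividing by \<open>s\<close> yields
  the common point. Some class has positive weight, and equality makes \<open>s\<close> positive for
  all.\<close>

lemma captures_sarkaria:
  fixes X :: "'a::euclidean_space set"
  assumes "finite X" "1 \<le> r" "\<forall>x. \<sigma> x < r"
  shows "captures (sarkaria r) X \<sigma> \<longleftrightarrow> (\<Inter>i<r. convex hull (classes_of X \<sigma> i)) \<noteq> {}"
proof
  assume "captures (sarkaria r) X \<sigma>"
  then obtain a where a: "\<forall>x\<in>X. 0 \<le> a x" "\<exists>x\<in>X. a x \<noteq> 0" "(\<Sum>x\<in>X. a x *\<^sub>R sarkaria r x (\<sigma> x)) = 0"
    unfolding captures_def by blast
  define w where "w = (\<Sum>x\<in>classes_of X \<sigma> (r - 1). a x *\<^sub>R (x, 1::real))"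
  have w: "(\<Sum>x\<in>classes_of X \<sigma> j. a x *\<^sub>R (x, 1::real)) = w" if "j < r" for j
    using a(3) sarkaria_combination[OF assms(1,3)] that unfolding w_def classes_of_def by blast
  obtain z s where zs: "w = (z, s)" by (cases w)
  have z: "(\<Sum>x\<in>classes_of X \<sigma> j. a x *\<^sub>R x) = z" and s: "(\<Sum>x\<in>classes_of X \<sigma> j. a x) = s" if "j < r" for j
    using arg_cong[OF w[OF that], of fst] arg_cong[OF w[OF that], of snd] zs
    by (simp_all add: fst_sum snd_sum)
  obtain y where y: "y \<in> X" "a y \<noteq> 0" using a by blast
  have "a y \<le> sum a (classes_of X \<sigma> (\<sigma> y))"
    using y a(1) assms(1) by (intro member_le_sum) (auto simp: classes_of_def)
  moreover have "0 < a y" using a(1) y by force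
  ultimately have s0: "0 < s" using s[of "\<sigma> y"] assms(3) by simp
  have "(1 / s) *\<^sub>R z \<in> convex hull (classes_of X \<sigma> j)" if j: "j < r" for j
  proof -
    have "(\<Sum>x\<in>classes_of X \<sigma> j. (a x / s) *\<^sub>R x) \<in> convex hull (classes_of X \<sigma> j)"
    proof (rule convex_sum)
      show "(\<Sum>x\<in>classes_of X \<sigma> j. a x / s) = 1"
        using s[OF j] s0 by (simp add: sum_divide_distrib[symmetric])
    qed (use assms(1) a(1) s0 in \<open>auto simp: classes_of_def intro: hull_inc\<close>)
    also have "(\<Sum>x\<in>classes_of X \<sigma> j. (a x / s) *\<^sub>R x) = (1 / s) *\<^sub>R (\<Sum>x\<in>classes_of X \<sigma> j. a x *\<^sub>R x)"
      by (simp add: scaleR_sum_right)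
    finally show ?thesis using z[OF j] by simp
  qed
  then show "(\<Inter>i<r. convex hull (classes_of X \<sigma> i)) \<noteq> {}" by blast
next
  assume "(\<Inter>i<r. convex hull (classes_of X \<sigma> i)) \<noteq> {}"
  then obtain p where p: "\<And>i. i < r \<Longrightarrow> p \<in> convex hull (classes_of X \<sigma> i)" by blast
  have fin: "finite (classes_of X \<sigma> i)" for i using assms(1) by (simp add: classes_of_def)
  have "\<exists>b. (\<forall>x\<in>classes_of X \<sigma> i. 0 \<le> b x) \<and> sum b (classes_of X \<sigma> i) = 1 \<and>
      (\<Sum>x\<in>classes_of X \<sigma> i. b x *\<^sub>R x) = p" if "i < r" for i
    using p[OF that] convex_hull_finite[OF fin] by auto
  then obtain b where b: "\<And>i x. i < r \<Longrightarrow> x \<in> classes_of X \<sigma> i \<Longrightarrow> 0 \<le> b i x"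
    "\<And>i. i < r \<Longrightarrow> sum (b i) (classes_of X \<sigma> i) = 1"
    "\<And>i. i < r \<Longrightarrow> (\<Sum>x\<in>classes_of X \<sigma> i. b i x *\<^sub>R x) = p" by metis
  define a where "a x = b (\<sigma> x) x" for x
  have "(\<Sum>x\<in>classes_of X \<sigma> j. a x *\<^sub>R (x, 1::real)) = (p, 1)" if "j < r" for j
  proof -
    have "(\<Sum>x\<in>classes_of X \<sigma> j. a x *\<^sub>R (x, 1::real)) = (\<Sum>x\<in>classes_of X \<sigma> j. (b j x *\<^sub>R x, b j x))"
      by (intro sum.cong) (auto simp: a_def classes_of_def)
    also have "\<dots> = (p, 1)" using b(2,3)[OF that] by (simp add: sum_prod)
    finally show ?thesis .
  qed
  then have "\<forall>j<r. (\<Sum>x | x \<in> X \<and> \<sigma> x = j. a x *\<^sub>R (x, 1)) = (\<Sum>x | x \<in> X \<and> \<sigma> x = r - 1. a x *\<^sub>R (x, 1::real))"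
    using assms(2) unfolding classes_of_def by simp
  then have "(\<Sum>x\<in>X. a x *\<^sub>R sarkaria r x (\<sigma> x)) = 0" using sarkaria_combination[OF assms(1,3)] by blast
  moreover have "\<forall>x\<in>X. 0 \<le> a x" using b(1) assms(3) by (simp add: a_def classes_of_def)
  moreover have "\<exists>x\<in>X. a x \<noteq> 0"
  proof (rule ccontr)
    assume "\<not> ?thesis"
    then have "sum (b 0) (classes_of X \<sigma> 0) = 0" by (intro sum.neutral) (auto simp: a_def classes_of_def)
    then show False using b(2)[of 0] assms(2) by simp
  qed
  ultimately show "captures (sarkaria r) X \<sigma>" unfolding captures_def by blast
qed

lemma tverberg_partition_classes_of:
  assumes "finite X" "1 \<le> r" "\<forall>x. \<sigma> x < r"
  shows "tverberg_partition X r (classes_of X \<sigma>) \<longleftrightarrow> captures (sarkaria r) X \<sigma>"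
proof -
  have "classes_of X \<sigma> i = {}" if "r \<le> i" for i
  proof -
    have "\<sigma> x \<noteq> i" for x using assms(3) that by (metis leD)
    then show ?thesis by (simp add: classes_of_def)
  qed
  moreover have "(\<Union>i<r. classes_of X \<sigma> i) = X" using assms(3) by (auto simp: classes_of_def)
  moreover have "classes_of X \<sigma> i \<inter> classes_of X \<sigma> j = {}" if "i \<noteq> j" for i j
    using that by (auto simp: classes_of_def)
  ultimately show ?thesis unfolding tverberg_partition_def captures_sarkaria[OF assms] by simp
qed

text \<open>The default label 0 off \<open>X\<close> makes any two labellings agree there, as
  \<open>moves_connected\<close> demands; it is a legal label because
  \<open>r \<ge> 1\<close>.\<close>

lemma tverberg_partition_labelling:
  assumes "tverberg_partition X r P" "1 \<le> r"
  obtains \<sigma> where "\<forall>x. \<sigma> x < r" "\<forall>x. x \<notin> X \<longrightarrow> \<sigma> x = 0" "P = classes_of X \<sigma>"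
proof -
  have P: "\<And>i j. i < r \<Longrightarrow> j < r \<Longrightarrow> i \<noteq> j \<Longrightarrow> P i \<inter> P j = {}" "(\<Union>i<r. P i) = X" "\<And>i. r \<le> i \<Longrightarrow> P i = {}"
    using assms(1) unfolding tverberg_partition_def by auto
  have "\<forall>x\<in>X. \<exists>i. i < r \<and> x \<in> P i" using P(2) by blast
  then obtain f where f: "\<And>x. x \<in> X \<Longrightarrow> f x < r \<and> x \<in> P (f x)" by metis
  define \<sigma> where "\<sigma> x = (if x \<in> X then f x else 0)" for x
  have "P i = classes_of X \<sigma> i" for i
  proof (cases "i < r")
    case True
    show ?thesis
    proof (intro set_eqI iffI)
      fix x assume x: "x \<in> P i"
      then have X: "x \<in> X" using P(2) True by blast
      then have "f x = i" using P(1)[of i "f x"] f[OF X] True x by blast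
      then show "x \<in> classes_of X \<sigma> i" using X by (simp add: classes_of_def \<sigma>_def)
    qed (use f in \<open>auto simp: classes_of_def \<sigma>_def\<close>)
  next
    case False
    then have "x \<notin> classes_of X \<sigma> i" for x using f[of x] by (auto simp: classes_of_def \<sigma>_def)
    then show ?thesis using P(3) False by auto
  qed
  then have "P = classes_of X \<sigma>" by blast
  moreover have "\<forall>x. \<sigma> x < r" using f assms(2) by (auto simp: \<sigma>_def)
  ultimately show ?thesis using that[of \<sigma>] by (simp add: \<sigma>_def)
qed

text \<open>A move may keep the label, whereas adjacent partitions differ; hence the reflexive
  closure in the conclusion.\<close>

lemma moves_imp_edges:
  assumes "finite X" "1 \<le> r" "(\<sigma>, \<sigma>') \<in> moves (sarkaria r) r X"
  shows "(classes_of X \<sigma>, classes_of X \<sigma>') \<in> (RG_Tv_edges X r)\<^sup>*"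
proof (cases "classes_of X \<sigma> = classes_of X \<sigma>'")
  case False
  obtain y i where yi: "y \<in> X" "i < r" "\<forall>x. \<sigma> x < r" "captures (sarkaria r) (X - {y}) \<sigma>" "\<sigma>' = \<sigma>(y := i)"
    using assms(3) unfolding moves_def by blast
  have s': "\<forall>x. \<sigma>' x < r" using yi by simp
  have c': "captures (sarkaria r) (X - {y}) \<sigma>'"
    using yi(4) captures_cong[of "X - {y}" \<sigma> \<sigma>' "sarkaria r"] yi(5) by auto
  have del: "classes_of X \<rho> j - {y} = classes_of (X - {y}) \<rho> j" for \<rho> :: "'a \<Rightarrow> nat" and j
    by (auto simp: classes_of_def)
  have part: "tverberg_partition X r (classes_of X \<rho>)" "tverberg_partition (X - {y}) r (\<lambda>j. classes_of X \<rho> j - {y})"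
    if "captures (sarkaria r) (X - {y}) \<rho>" "\<forall>x. \<rho> x < r" for \<rho>
    using that captures_mono[OF that(1) _ assms(1)] tverberg_partition_classes_of[OF _ assms(2) that(2)] assms(1)
    unfolding del by auto
  have "tv_adjacent X r (classes_of X \<sigma>) (classes_of X \<sigma>')"
    unfolding tv_adjacent_def
  proof (intro conjI bexI[OF _ yi(1)])
    show "\<forall>j. classes_of X \<sigma> j - {y} = classes_of X \<sigma>' j - {y}" using yi(5) by (auto simp: classes_of_def)
  qed (use False part[OF yi(4,3)] part[OF c' s'] in auto)
  then show ?thesis unfolding RG_Tv_edges_def by auto
qed simp

theorem theorem1p2:
  fixes X :: "'a::euclidean_space set" and r :: nat
  assumes "finite X" and "r \<ge> 1"
    and "card X \<ge> (DIM('a) + 1) * (r - 1) + 2"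
  shows "\<forall>P Q. tverberg_partition X r P \<and> tverberg_partition X r Q
           \<longrightarrow> (P, Q) \<in> (RG_Tv_edges X r)\<^sup>*"
proof (intro allI impI)
  fix P Q assume "tverberg_partition X r P \<and> tverberg_partition X r Q"
  then have PQ: "tverberg_partition X r P" "tverberg_partition X r Q" by auto
  obtain \<sigma> where \<sigma>: "\<forall>x. \<sigma> x < r" "\<forall>x. x \<notin> X \<longrightarrow> \<sigma> x = 0" "P = classes_of X \<sigma>"
    using tverberg_partition_labelling[OF PQ(1) assms(2)] by blast
  obtain \<rho> where \<rho>: "\<forall>x. \<rho> x < r" "\<forall>x. x \<notin> X \<longrightarrow> \<rho> x = 0" "Q = classes_of X \<rho>"
    using tverberg_partition_labelling[OF PQ(2) assms(2)] by blast
  show "(P, Q) \<in> (RG_Tv_edges X r)\<^sup>*"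
  \<comment> \<open>With one class there is only one labelling; the general argument divides by
    \<open>r - 1\<close>.\<close>
  proof (cases "r = 1")
    case True
    then have "\<sigma> = \<rho>" using \<sigma>(1) \<rho>(1) by (simp add: fun_eq_iff)
    then show ?thesis using \<sigma>(3) \<rho>(3) by simp
  next
    case False
    let ?U = "unit_sequences (r - 1) :: (nat \<Rightarrow>\<^sub>C ('a \<times> real)) set"
    obtain B where B: "B \<subseteq> ?U" "independent B" "?U \<subseteq> span B"
      using maximal_independent_subset by blast
    \<comment> \<open>The lift to \<open>'a \<times> real\<close> contributes the factor
      \<open>d + 1\<close>, the \<open>r - 1\<close> coordinates the other one.\<close>
    have "card B \<le> card ?U" using B(1) unit_sequences_card(1) by (rule card_mono[rotated])
    also have "\<dots> \<le> (r - 1) * (DIM('a) + 1)" using unit_sequences_card(2)[of "r - 1", where 'b = "'a \<times> real"] by simp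
    finally have cB: "card B + 2 \<le> card X" using assms(3) by (simp add: mult.commute)
    have fB: "finite B" using B(1) unit_sequences_card(1) finite_subset by blast
    interpret finite_basis B using fB B(2) by unfold_locales
    have "span ?U \<subseteq> span B" using B(3) by (simp add: span_minimal)
    then have zs: "zero_sum (sarkaria r) r X (span B)"
      unfolding zero_sum_def using padded_in_span sarkaria_sum[OF assms(2)] by (auto simp: sarkaria_def)
    have "(\<sigma>, \<rho>) \<in> (moves (sarkaria r) r X)\<^sup>*"
      using moves_connected[OF assms(1) cB zs, of \<sigma> \<rho>] \<sigma> \<rho> PQ False assms(2)
        tverberg_partition_classes_of[OF assms(1,2)] by auto
    then have "(classes_of X \<sigma>, classes_of X \<rho>) \<in> (RG_Tv_edges X r)\<^sup>*"
    proof (induction rule: rtrancl_induct)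
      case (step \<theta> \<theta>')
      then show ?case using moves_imp_edges[OF assms(1,2)] rtrancl_trans by metis
    qed simp
    then show ?thesis using \<sigma>(3) \<rho>(3) by simp
  qed
qed

end
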